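(* There is a polynomial time algorithm which, given positive integers $m,n$, functions $f_i:\{0,1,\dots,n\}\to\mathbb{Z}$ for $i\in\{1,\dots,m\}$, and functions $g_j:\{0,1,\dots,m\}\to\mathbb{Z}$ for $j\in\{1,\dots,n\}$, computes a monotone matrix $A\in\{0,1\}^{m\times n}$ which minimizes $$\sum_{i=1}^m f_i(r_i(A))+\sum_{j=1}^n g_j(c_j(A))$$ over all monotone matrices in $\{0,1\}^{m\times n}$.
   Context: For an $m\times n$ matrix $A$, the row sums are $r_i(A):=\sum_{j=1}^n A_{i,j}$ for $i\in\{1,\dots,m\}$ and the column sums are $c_j(A):=\sum_{i=1}^m A_{i,j}$ for $j\in\{1,\dots,n\}$. The matrix $A$ is called monotone if it has nonincreasing row sums and nonincreasing column sums, that is, $r_1(A)\geq\cdots\geq r_m(A)$ and $c_1(A)\geq\cdots\geq c_n(A)$. The functions $f_i$ and $g_j$ are arbitrary (no convexity or monotonicity is assumed, and they need not be identical) and are given as part of the input by the lists of their integer values, with integers encoded in binary; polynomial time means that the running time is bounded by a polynomial in the length of the input. *)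

theory Defs
  imports
    "HOL-Library.Log_Nat"
    "HOL-Computational_Algebra.Polynomial"
    "Jordan_Normal_Form.Matrix"
begin

section \<open>Algorithms and running time\<close>

text \<open>
  The model of computation is the random access machine with logarithmic cost (Cook and Reckhow;
  Aho, Hopcroft and Ullman): registers indexed by the natural numbers, each holding an integer of
  arbitrary size, indirect addressing, a read-only input tape and a write-only output tape of
  integers, and a charge of the binary length of every integer and every address handled. Control
  flow is given by while programs instead of jumps. Under the logarithmic charge this model and
  Turing machines simulate each other with polynomial overhead.
\<close>

text \<open>One symbol for the sign, which also serves as separator, plus the binary digits of the
  absolute value (none for zero).\<close>

definition int_length :: "int \<Rightarrow> nat" where
  "int_length z = 1 + floorlog 2 (nat \<bar>z\<bar>)"

definition input_length :: "int list \<Rightarrow> nat" where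
  "input_length xs = sum_list (map int_length xs)"

datatype expr =
    Const int
  | Reg expr
  | Add expr expr
  | Sub expr expr
  | Mult expr expr

datatype com =
    Skip
  | Store expr expr
  | Read expr
  | Write expr
  | Seq com com
  | Cond expr com com
  | While expr com

type_synonym memory = "nat \<Rightarrow> int"

text \<open>A negative address denotes register 0.\<close>

fun eval :: "expr \<Rightarrow> memory \<Rightarrow> int" where
  "eval (Const z) M = z"
| "eval (Reg e) M = M (nat (eval e M))"
| "eval (Add a b) M = eval a M + eval b M"
| "eval (Sub a b) M = eval a M - eval b M"
| "eval (Mult a b) M = eval a M * eval b M"

text \<open>The lengths of all intermediate results are added up; in particular an access to a register
  pays for the address through the cost of the address expression.\<close>

fun eval_cost :: "expr \<Rightarrow> memory \<Rightarrow> nat" where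
  "eval_cost (Const z) M = int_length z"
| "eval_cost (Reg e) M = eval_cost e M + int_length (eval (Reg e) M)"
| "eval_cost (Add a b) M = eval_cost a M + eval_cost b M + int_length (eval (Add a b) M)"
| "eval_cost (Sub a b) M = eval_cost a M + eval_cost b M + int_length (eval (Sub a b) M)"
| "eval_cost (Mult a b) M = eval_cost a M + eval_cost b M + int_length (eval (Mult a b) M)"

text \<open>A state consists of the memory, the unread part of the input and the output written so far.
  \<open>exec c s t s'\<close> states that \<open>c\<close> started in \<open>s\<close> halts in \<open>s'\<close> after time \<open>t\<close>. Tests in
  conditionals and loops succeed iff the value is positive. Reading past the end of the input
  has no successor state, so such a run does not count as halting.\<close>

type_synonym state = "memory \<times> int list \<times> int list"

inductive exec :: "com \<Rightarrow> state \<Rightarrow> nat \<Rightarrow> state \<Rightarrow> bool" where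
  Skip: "exec Skip s 1 s"
| Store: "exec (Store a e) (M, xs, ys) (eval_cost a M + eval_cost e M)
    (M(nat (eval a M) := eval e M), xs, ys)"
| Read: "exec (Read a) (M, x # xs, ys) (eval_cost a M + int_length x)
    (M(nat (eval a M) := x), xs, ys)"
| Write: "exec (Write e) (M, xs, ys) (eval_cost e M) (M, xs, ys @ [eval e M])"
| Seq: "exec c1 s t1 s1 \<Longrightarrow> exec c2 s1 t2 s2 \<Longrightarrow> exec (Seq c1 c2) s (t1 + t2) s2"
| CondTrue: "eval e (fst s) > 0 \<Longrightarrow> exec c1 s t s' \<Longrightarrow>
    exec (Cond e c1 c2) s (eval_cost e (fst s) + t) s'"
| CondFalse: "\<not> eval e (fst s) > 0 \<Longrightarrow> exec c2 s t s' \<Longrightarrow>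
    exec (Cond e c1 c2) s (eval_cost e (fst s) + t) s'"
| WhileTrue: "eval e (fst s) > 0 \<Longrightarrow> exec c s t1 s1 \<Longrightarrow> exec (While e c) s1 t2 s2 \<Longrightarrow>
    exec (While e c) s (eval_cost e (fst s) + t1 + t2) s2"
| WhileFalse: "\<not> eval e (fst s) > 0 \<Longrightarrow> exec (While e c) s (eval_cost e (fst s)) s"

inductive_cases SkipE: "exec Skip s t s'"
inductive_cases StoreE: "exec (Store a e) s t s'"
inductive_cases ReadE: "exec (Read a) s t s'"
inductive_cases WriteE: "exec (Write e) s t s'"
inductive_cases SeqE: "exec (Seq c1 c2) s t s'"
inductive_cases CondE: "exec (Cond e c1 c2) s t s'"
inductive_cases WhileE: "exec (While e c) s t s'"

lemma exec_deterministic: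
  "exec c s t s' \<Longrightarrow> exec c s u s'' \<Longrightarrow> t = u \<and> s' = s''"
proof (induction arbitrary: u s'' rule: exec.induct)
  case (Skip s)
  then show ?case by (auto elim: SkipE)
next
  case (Store a e M xs ys)
  then show ?case by (auto elim: StoreE)
next
  case (Read a M x xs ys)
  then show ?case by (auto elim: ReadE)
next
  case (Write e M xs ys)
  then show ?case by (auto elim: WriteE)
next
  case (Seq c1 s t1 s1 c2 t2 s2)
  from Seq.prems show ?case by (rule SeqE) (use Seq.IH in blast)
next
  case (CondTrue e s c1 t s' c2)
  from CondTrue.prems show ?case by (rule CondE) (use CondTrue.IH CondTrue.hyps in blast)+
next
  case (CondFalse e s c2 t s' c1)
  from CondFalse.prems show ?case by (rule CondE) (use CondFalse.IH CondFalse.hyps in blast)+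
next
  case (WhileTrue e s c t1 s1 t2 s2)
  from WhileTrue.prems show ?case by (rule WhileE) (use WhileTrue.IH WhileTrue.hyps in blast)+
next
  case (WhileFalse e s c)
  from WhileFalse.prems show ?case by (rule WhileE) (use WhileFalse.hyps in blast)+
qed

definition computes_in_time :: "com \<Rightarrow> int list \<Rightarrow> int list \<Rightarrow> nat \<Rightarrow> bool" where
  "computes_in_time P xs ys t \<longleftrightarrow> (\<exists>M zs. exec P (\<lambda>_. 0, xs, []) t (M, zs, ys))"


section \<open>Monotone matrices\<close>

text \<open>Rows and columns are indexed from 0. Entries are natural numbers, so that the row and column
  sums of a 0-1 matrix can be used directly as arguments of the given functions.\<close>

definition row_sum :: "nat mat \<Rightarrow> nat \<Rightarrow> nat" where
  "row_sum A i = (\<Sum>j<dim_col A. A $$ (i, j))"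

definition col_sum :: "nat mat \<Rightarrow> nat \<Rightarrow> nat" where
  "col_sum A j = (\<Sum>i<dim_row A. A $$ (i, j))"

definition monotone_mat :: "nat mat \<Rightarrow> bool" where
  "monotone_mat A \<longleftrightarrow>
     antimono_on {..<dim_row A} (row_sum A) \<and> antimono_on {..<dim_col A} (col_sum A)"

definition monotone_01_mats :: "nat \<Rightarrow> nat \<Rightarrow> nat mat set" where
  "monotone_01_mats m n = {A \<in> carrier_mat m n. elements_mat A \<subseteq> {0, 1} \<and> monotone_mat A}"

text \<open>Only the values \<open>f i k\<close> for \<open>i < m\<close>, \<open>k \<le> n\<close> and \<open>g j k\<close> for \<open>j < n\<close>, \<open>k \<le> m\<close> matter,
  both here and in the encoding below.\<close>

definition degree_cost ::
    "(nat \<Rightarrow> nat \<Rightarrow> int) \<Rightarrow> (nat \<Rightarrow> nat \<Rightarrow> int) \<Rightarrow> nat mat \<Rightarrow> int" where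
  "degree_cost f g A =
     (\<Sum>i<dim_row A. f i (row_sum A i)) + (\<Sum>j<dim_col A. g j (col_sum A j))"

definition encode_instance ::
    "nat \<Rightarrow> nat \<Rightarrow> (nat \<Rightarrow> nat \<Rightarrow> int) \<Rightarrow> (nat \<Rightarrow> nat \<Rightarrow> int) \<Rightarrow> int list" where
  "encode_instance m n f g =
     [int m, int n]
     @ [f i k. i \<leftarrow> [0..<m], k \<leftarrow> [0..<n + 1]]
     @ [g j k. j \<leftarrow> [0..<n], k \<leftarrow> [0..<m + 1]]"

definition encode_mat :: "nat mat \<Rightarrow> int list" where
  "encode_mat A = [int (A $$ (i, j)). i \<leftarrow> [0..<dim_row A], j \<leftarrow> [0..<dim_col A]]"

end

theory Submission
  imports Defs
begin

text \<open>
  Let \<open>\<rho>\<close> be the row sums of a monotone matrix and \<open>\<kappa>\<close> the conjugate of its column sums. By Gale and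
  Ryser, \<open>\<rho>\<close> is realizable exactly if the partial sums of \<open>\<kappa>\<close> dominate those of \<open>\<rho>\<close>, with equality
  at the end; the cost of the columns is a sum over the drops of \<open>\<kappa>\<close>. Hence a dynamic program that
  scans \<open>\<rho>\<close> and \<open>\<kappa>\<close> simultaneously only has to remember their current values and the excess of the
  partial sums, which is at most \<open>m * n\<close>. An optimal pair yields a matrix: start from the Ferrers
  matrix with row sums \<open>\<kappa>\<close> and, for every row with a deficit, move ones within their columns from
  earlier rows with a surplus. The time bound is syntactic: if all numbers in memory have length at
  most \<open>w\<close> and every loop makes at most \<open>N\<close> iterations, then a fixed program runs in time polynomial
  in \<open>w\<close> and \<open>N\<close>.
\<close>

section \<open>Execution with a syntactic time bound\<close>

text \<open>Without convexity the cost of a column must be charged exactly when its sum is known.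
  Monotonicity makes this possible: the columns have a fixed order, and column \<open>j\<close> gets
  its final sum at the unique moment when the conjugate drops to \<open>j\<close> or below. All
  values of \<open>f\<close> and \<open>g\<close> are thus charged in one sweep, and the past enters
  Gale-Ryser only through the excess of the partial sums, which keeps the number of states
  polynomial. Monotonicity of \<rho> also drives the repair: a row \<open>p\<close> with surplus has
  more than \<open>\<rho> p\<close> ones, a later row \<open>q\<close> with deficit has fewer than
  \<open>\<rho> q\<close>, and \<open>\<rho> q\<close> is at most \<open>\<rho> p\<close>, so some
  column has a one in row \<open>p\<close> and a zero in row \<open>q\<close>. Dominance of the
  partial sums provides an earlier surplus for every deficit. The input lists 2mn + m + n + 2
  integers, so its length L bounds all loop counts, and all stored numbers stay below 2 to the power
  2 + 2L in absolute value, up to equality.\<close>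

fun size_bound :: "expr \<Rightarrow> nat" where
  "size_bound (Const z) = Suc (nat \<bar>z\<bar>)"
| "size_bound (Reg e) = 1"
| "size_bound (Add a b) = size_bound a + size_bound b"
| "size_bound (Sub a b) = size_bound a + size_bound b"
| "size_bound (Mult a b) = size_bound a + size_bound b"

fun cost_bound :: "nat \<Rightarrow> expr \<Rightarrow> nat" where
  "cost_bound w (Const z) = w * size_bound (Const z) + 2"
| "cost_bound w (Reg e) = cost_bound w e + (w + 2)"
| "cost_bound w (Add a b) = cost_bound w a + cost_bound w b + (w * size_bound (Add a b) + 2)"
| "cost_bound w (Sub a b) = cost_bound w a + cost_bound w b + (w * size_bound (Sub a b) + 2)"
| "cost_bound w (Mult a b) = cost_bound w a + cost_bound w b + (w * size_bound (Mult a b) + 2)"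

text \<open>Here \<open>w\<close> bounds the length of the numbers in memory and \<open>N\<close> the number of iterations of
  each single execution of a loop.\<close>

fun time_bound :: "nat \<Rightarrow> nat \<Rightarrow> com \<Rightarrow> nat" where
  "time_bound w N Skip = 1"
| "time_bound w N (Store a e) = cost_bound w a + cost_bound w e"
| "time_bound w N (Read a) = cost_bound w a + (w + 2)"
| "time_bound w N (Write e) = cost_bound w e"
| "time_bound w N (Seq c1 c2) = time_bound w N c1 + time_bound w N c2"
| "time_bound w N (Cond e c1 c2) = cost_bound w e + time_bound w N c1 + time_bound w N c2"
| "time_bound w N (While e c) = (N + 1) * (cost_bound w e + time_bound w N c)"

text \<open>The extreme value \<open>2 ^ k\<close> takes \<open>k + 1\<close> binary digits; the
  sign symbol accounts for the other unit.\<close>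

lemma int_length_le:
  assumes "\<bar>z\<bar> \<le> 2 ^ k"
  shows "int_length z \<le> k + 2"
proof -
  have "nat \<bar>z\<bar> \<le> 2 ^ k"
    using assms by (simp add: nat_le_iff)
  then have "nat \<bar>z\<bar> < 2 ^ (k + 1)"
    by (rule le_less_trans) simp
  then have "floorlog 2 (nat \<bar>z\<bar>) \<le> k + 1"
    by (intro floorlog_leI) auto
  then show ?thesis
    by (simp add: int_length_def)
qed

lemma abs_less_two_power_int_length: "\<bar>z\<bar> < 2 ^ int_length z"
proof -
  have "nat \<bar>z\<bar> < 2 ^ floorlog 2 (nat \<bar>z\<bar>)"
    by (rule floorlog_leD) auto
  also have "\<dots> \<le> 2 ^ int_length z"
    unfolding int_length_def by (rule power_increasing) auto
  finally have "int (nat \<bar>z\<bar>) < int (2 ^ int_length z)"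
    by (simp only: of_nat_less_iff)
  then show ?thesis by simp
qed

lemma size_bound_pos: "size_bound e > 0"
  by (induction e) auto

lemma two_power_add_le:
  fixes x y :: nat
  assumes "x > 0" "y > 0"
  shows "(2 :: int) ^ x + 2 ^ y \<le> 2 ^ (x + y)"
proof -
  obtain x' y' where xy: "x = Suc x'" "y = Suc y'"
    using assms by (metis gr0_conv_Suc)
  \<comment> \<open>Expanding this product gives the claim; both factors are at least 1 because the
    exponents are positive.\<close>
  have "(2 ^ x - 1) * (2 ^ y - 1) \<ge> (1 :: int) * 1"
  proof (rule mult_mono)
    show "1 \<le> (2 :: int) ^ x - 1" "1 \<le> (2 :: int) ^ y - 1"
      using one_le_power[of "2 :: int" x'] one_le_power[of "2 :: int" y']
      unfolding xy power_Suc by linarith+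
    then show "0 \<le> (2 :: int) ^ x - 1" by linarith
  qed auto
  then show ?thesis by (simp add: algebra_simps power_add)
qed

text \<open>\<open>size_bound\<close> counts the multiples of \<open>w\<close> that the exponent can
  accumulate. Products add exponents, and by \<open>two_power_add_le\<close> so may sums; reading a
  register resets the exponent to \<open>w\<close>, however large the address is.\<close>

lemma abs_eval_le:
  assumes "\<forall>a. \<bar>M a\<bar> \<le> 2 ^ w" "w > 0"
  shows "\<bar>eval e M\<bar> \<le> 2 ^ (w * size_bound e)"
proof (induction e)
  case (Const z)
  have "\<bar>z\<bar> = int (nat \<bar>z\<bar>)" by simp
  also have "\<dots> \<le> int (2 ^ nat \<bar>z\<bar>)"
    by (simp only: of_nat_le_iff) (rule less_imp_le[OF less_exp])
  also have "\<dots> \<le> int (2 ^ (w * size_bound (Const z)))"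
    using assms(2) unfolding of_nat_le_iff by (intro power_increasing) (cases w; simp)+
  finally show ?case by simp
next
  case (Reg e)
  then show ?case using assms by simp
next
  case (Add a b)
  then show ?case
    using two_power_add_le[of "w * size_bound a" "w * size_bound b"] assms(2) size_bound_pos[of a]
      size_bound_pos[of b] by (simp add: algebra_simps)
next
  case (Sub a b)
  then show ?case
    using two_power_add_le[of "w * size_bound a" "w * size_bound b"] assms(2) size_bound_pos[of a]
      size_bound_pos[of b] by (simp add: algebra_simps)
next
  case (Mult a b)
  then show ?case
    by (simp add: abs_mult algebra_simps power_add mult_mono)
qed

lemma eval_cost_le:
  assumes "\<forall>a. \<bar>M a\<bar> \<le> 2 ^ w" "w > 0"
  shows "eval_cost e M \<le> cost_bound w e"
proof (induction e)
  case (Const z)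
  show ?case using int_length_le[OF abs_eval_le[OF assms, of "Const z"]] by simp
next
  case (Reg e)
  then show ?case using int_length_le[OF abs_eval_le[OF assms, of "Reg e"]] by simp
next
  case (Add a b)
  then show ?case using int_length_le[OF abs_eval_le[OF assms, of "Add a b"]] by simp
next
  case (Sub a b)
  then show ?case using int_length_le[OF abs_eval_le[OF assms, of "Sub a b"]] by simp
next
  case (Mult a b)
  then show ?case using int_length_le[OF abs_eval_le[OF assms, of "Mult a b"]] by simp
qed

section \<open>Polynomiality of the syntactic bounds\<close>

lemma poly_times_bound:
  fixes f g :: "nat \<Rightarrow> nat"
  assumes "\<exists>p :: nat poly. \<forall>x. f x = poly p x" "\<exists>p :: nat poly. \<forall>x. g x = poly p x"
  shows "\<exists>p :: nat poly. \<forall>x. f x + g x = poly p x" "\<exists>p :: nat poly. \<forall>x. f x * g x = poly p x"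
  using assms by (metis poly_add, metis poly_mult)

lemma cost_bound_poly:
  fixes q :: "nat poly"
  shows "\<exists>p :: nat poly. \<forall>x. cost_bound (poly q x) e = poly p x"
proof -
  have c: "\<exists>p :: nat poly. \<forall>x. k = poly p x" for k
    by (rule exI[of _ "[:k:]"]) simp
  have q: "\<exists>p :: nat poly. \<forall>x. poly q x = poly p x" by blast
  show ?thesis
    by (induction e; simp only: cost_bound.simps) (intro poly_times_bound c q; assumption)+
qed

text \<open>The program is a constant here, and the parameters enter only through sums and products.
  The running time analysis thereby reduces to bounding register sizes and loop counts.\<close>

lemma time_bound_poly:
  fixes q r :: "nat poly"
  shows "\<exists>p :: nat poly. \<forall>x. time_bound (poly q x) (poly r x) c = poly p x"
proof -
  have c: "\<exists>p :: nat poly. \<forall>x. k = poly p x" for k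
    by (rule exI[of _ "[:k:]"]) simp
  have q: "\<exists>p :: nat poly. \<forall>x. poly q x = poly p x" for q :: "nat poly" by blast
  show ?thesis
    by (induction c; simp only: time_bound.simps)
      (intro poly_times_bound c q cost_bound_poly; assumption)+
qed

section \<open>Weakest preconditions\<close>

text \<open>The unread input is included because \<open>Read\<close> moves it into memory.\<close>

definition bounded_by :: "nat \<Rightarrow> memory \<Rightarrow> int list \<Rightarrow> bool" where
  "bounded_by w M xs \<longleftrightarrow> (\<forall>a. \<bar>M a\<bar> \<le> 2 ^ w) \<and> (\<forall>x\<in>set xs. \<bar>x\<bar> \<le> 2 ^ w)"

type_synonym assertion = "memory \<Rightarrow> int list \<Rightarrow> int list \<Rightarrow> bool"

locale machine =
  fixes w N :: nat
  assumes w_pos: "w > 0"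
    and N_le: "int N \<le> 2 ^ w"
begin

text \<open>Boundedness is both a hypothesis and part of the result, so assertions need not carry it
  along. The time bound depends on the command alone and never enters \<open>Q\<close>.\<close>

definition wp :: "com \<Rightarrow> assertion \<Rightarrow> assertion" where
  "wp c Q M xs ys \<longleftrightarrow> (bounded_by w M xs \<longrightarrow> (\<exists>t M' xs' ys'. exec c (M, xs, ys) t (M', xs', ys') \<and>
     t \<le> time_bound w N c \<and> bounded_by w M' xs' \<and> Q M' xs' ys'))"

lemma eval_cost_le': "bounded_by w M xs \<Longrightarrow> eval_cost e M \<le> cost_bound w e"
  using eval_cost_le w_pos unfolding bounded_by_def by blast

lemma wp_mono:
  assumes "wp c Q M xs ys" "\<And>M xs ys. bounded_by w M xs \<Longrightarrow> Q M xs ys \<Longrightarrow> Q' M xs ys"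
  shows "wp c Q' M xs ys"
  using assms unfolding wp_def by meson

lemma wp_Skip: "Q M xs ys \<Longrightarrow> wp Skip Q M xs ys"
  unfolding wp_def using exec.Skip by fastforce

text \<open>The size condition may use that the old memory is bounded; counters can therefore be
  updated without a bound of their own in the invariant.\<close>

lemma wp_Store:
  assumes "bounded_by w M xs \<Longrightarrow> \<bar>eval e M\<bar> \<le> 2 ^ w" "Q (M(nat (eval a M) := eval e M)) xs ys"
  shows "wp (Store a e) Q M xs ys"
  unfolding wp_def
proof
  assume b: "bounded_by w M xs"
  show "\<exists>t M' xs' ys'. exec (Store a e) (M, xs, ys) t (M', xs', ys') \<and>
     t \<le> time_bound w N (Store a e) \<and> bounded_by w M' xs' \<and> Q M' xs' ys'"
    by (intro exI conjI, rule exec.Store)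
      (use assms eval_cost_le'[OF b, of a] eval_cost_le'[OF b,
          of e] b in \<open>auto simp: bounded_by_def\<close>)
qed

lemma wp_Read:
  assumes "Q (M(nat (eval a M) := x)) xs ys"
  shows "wp (Read a) Q M (x # xs) ys"
  unfolding wp_def
proof
  assume b: "bounded_by w M (x # xs)"
  have len: "int_length x \<le> w + 2"
    using b by (intro int_length_le) (simp add: bounded_by_def)
  show "\<exists>t M' xs' ys'. exec (Read a) (M, x # xs, ys) t (M', xs', ys') \<and>
     t \<le> time_bound w N (Read a) \<and> bounded_by w M' xs' \<and> Q M' xs' ys'"
    by (intro exI conjI, rule exec.Read)
      (use assms len eval_cost_le'[OF b, of a] b in \<open>auto simp: bounded_by_def\<close>)
qed

lemma wp_Write:
  assumes "Q M xs (ys @ [eval e M])"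
  shows "wp (Write e) Q M xs ys"
  unfolding wp_def using assms exec.Write[of e M xs ys] eval_cost_le'[of M xs e] by fastforce

lemma wp_Seq:
  assumes "wp c1 (wp c2 Q) M xs ys"
  shows "wp (Seq c1 c2) Q M xs ys"
  unfolding wp_def
proof
  assume "bounded_by w M xs"
  then obtain t1 M1 xs1 ys1 where 1: "exec c1 (M, xs, ys) t1 (M1, xs1, ys1)"
    "t1 \<le> time_bound w N c1" "bounded_by w M1 xs1" "wp c2 Q M1 xs1 ys1"
    using assms unfolding wp_def[of c1] by blast
  then obtain t2 M2 xs2 ys2 where 2: "exec c2 (M1, xs1, ys1) t2 (M2, xs2, ys2)"
    "t2 \<le> time_bound w N c2" "bounded_by w M2 xs2" "Q M2 xs2 ys2"
    unfolding wp_def[of c2] by blast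
  show "\<exists>t M' xs' ys'. exec (Seq c1 c2) (M, xs, ys) t (M', xs', ys') \<and>
     t \<le> time_bound w N (Seq c1 c2) \<and> bounded_by w M' xs' \<and> Q M' xs' ys'"
    by (intro exI conjI, rule exec.Seq[OF 1(1) 2(1)]) (use 1 2 in auto)
qed

lemma wp_Cond:
  assumes "eval e M > 0 \<Longrightarrow> wp c1 Q M xs ys" "eval e M \<le> 0 \<Longrightarrow> wp c2 Q M xs ys"
  shows "wp (Cond e c1 c2) Q M xs ys"
  unfolding wp_def
proof
  assume b: "bounded_by w M xs"
  note cost = eval_cost_le'[OF b, of e]
  show "\<exists>t M' xs' ys'. exec (Cond e c1 c2) (M, xs, ys) t (M', xs', ys') \<and>
     t \<le> time_bound w N (Cond e c1 c2) \<and> bounded_by w M' xs' \<and> Q M' xs' ys'"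
  proof (cases "eval e M > 0")
    case True
    then obtain t M' xs' ys' where 1: "exec c1 (M, xs, ys) t (M', xs', ys')"
      "t \<le> time_bound w N c1" "bounded_by w M' xs'" "Q M' xs' ys'"
      using assms(1) b unfolding wp_def by blast
    show ?thesis
      by (intro exI conjI, rule exec.CondTrue[OF _ 1(1)]) (use True 1 cost in auto)
  next
    case False
    then obtain t M' xs' ys' where 1: "exec c2 (M, xs, ys) t (M', xs', ys')"
      "t \<le> time_bound w N c2" "bounded_by w M' xs'" "Q M' xs' ys'"
      using assms(2) b unfolding wp_def by force
    show ?thesis
      by (intro exI conjI, rule exec.CondFalse[OF _ 1(1)]) (use False 1 cost in auto)
  qed
qed

text \<open>The number \<open>K\<close> of iterations is fixed beforehand and the invariant is
  indexed by the iteration count, which yields termination and the time bound at once.\<close>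

lemma wp_While:
  assumes init: "J 0 M xs ys"
    and test: "\<And>k M xs ys. k \<le> K \<Longrightarrow> J k M xs ys \<Longrightarrow> eval e M > 0 \<longleftrightarrow> k < K"
    and step: "\<And>k M xs ys. k < K \<Longrightarrow> J k M xs ys \<Longrightarrow> wp c (J (Suc k)) M xs ys"
    and fin: "\<And>M xs ys. J K M xs ys \<Longrightarrow> Q M xs ys"
    and "K \<le> N"
  shows "wp (While e c) Q M xs ys"
  unfolding wp_def
proof
  assume b: "bounded_by w M xs"
  have "\<exists>t M' xs' ys'. exec (While e c) (M, xs, ys) t (M', xs', ys') \<and>
      t \<le> (K - k) * (cost_bound w e + time_bound w N c) + cost_bound w e \<and>
      bounded_by w M' xs' \<and> J K M' xs' ys'"
    if "k \<le> K" "J k M xs ys" "bounded_by w M xs" for k M xs ys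
    using that
  proof (induction "K - k" arbitrary: k M xs ys)
    case 0
    then have "\<not> eval e M > 0" using test[of k M xs ys] by simp
    then have "exec (While e c) (M, xs, ys) (eval_cost e M) (M, xs, ys)"
      using exec.WhileFalse[of e "(M, xs, ys)"] by simp
    moreover have "k = K" using 0 by simp
    ultimately show ?case using 0 eval_cost_le'[OF 0(4), of e] by (metis trans_le_add2)
  next
    case (Suc d)
    then have "k < K" by simp
    then obtain t1 M1 xs1 ys1 where 1: "exec c (M, xs, ys) t1 (M1, xs1, ys1)"
      "t1 \<le> time_bound w N c" "bounded_by w M1 xs1" "J (Suc k) M1 xs1 ys1"
      using step[of k M xs ys] Suc.prems unfolding wp_def by blast
    have d: "d = K - Suc k" using Suc by simp
    obtain t2 M2 xs2 ys2 where 2: "exec (While e c) (M1, xs1, ys1) t2 (M2, xs2, ys2)"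
      "t2 \<le> (K - Suc k) * (cost_bound w e + time_bound w N c) + cost_bound w e"
      "bounded_by w M2 xs2" "J K M2 xs2 ys2"
      using Suc.hyps(1)[OF d _ 1(4,3)] \<open>k < K\<close> by auto
    have "eval e M > 0" using test[of k M xs ys] Suc.prems \<open>k < K\<close> by simp
    then have "exec (While e c) (M, xs, ys) (eval_cost e M + t1 + t2) (M2, xs2, ys2)"
      using exec.WhileTrue[of e "(M, xs, ys)", OF _ 1(1) 2(1)] by simp
    moreover have "K - k = Suc (K - Suc k)" using \<open>k < K\<close> by simp
    then have "eval_cost e M + t1 + t2 \<le>
        (K - k) * (cost_bound w e + time_bound w N c) + cost_bound w e"
      using 1(2) 2(2) eval_cost_le'[OF Suc.prems(3), of e] by simp
    ultimately show ?case using 2 by blast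
  qed
  from this[of 0 M xs ys] obtain t M' xs' ys' where 1:
    "exec (While e c) (M, xs, ys) t (M', xs', ys')"
    "t \<le> K * (cost_bound w e + time_bound w N c) + cost_bound w e"
    "bounded_by w M' xs'" "J K M' xs' ys'"
    using init b by auto
  \<comment> \<open>\<open>K\<close> bodies come with \<open>K + 1\<close> tests; the factor
    \<open>N + 1\<close> in \<open>time_bound\<close> also pays for the final test.\<close>
  have "K * (cost_bound w e + time_bound w N c) \<le> N * (cost_bound w e + time_bound w N c)"
    using \<open>K \<le> N\<close> by (rule mult_le_mono1)
  then have "t \<le> N * (cost_bound w e + time_bound w N c) + (cost_bound w e + time_bound w N c)"
    using 1(2) by linarith
  then have "t \<le> time_bound w N (While e c)" by simp
  then show "\<exists>t M' xs' ys'. exec (While e c) (M, xs, ys) t (M', xs', ys') \<and>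
     t \<le> time_bound w N (While e c) \<and> bounded_by w M' xs' \<and> Q M' xs' ys'"
    using 1 fin by blast
qed

end

definition For :: "nat \<Rightarrow> expr \<Rightarrow> com \<Rightarrow> com" where
  "For v e c = Seq (Store (Const (int v)) (Const 0))
     (While (Sub e (Reg (Const (int v))))
       (Seq c (Store (Const (int v)) (Add (Reg (Const (int v))) (Const 1)))))"

context machine
begin

text \<open>The loop itself overwrites the counter register, so the invariant has to be insensitive
  to it (\<open>frame\<close>); the body is told its value separately.\<close>

lemma wp_For:
  assumes init: "J 0 M xs ys"
    and bound: "\<And>k M xs ys. k \<le> K \<Longrightarrow> J k M xs ys \<Longrightarrow> eval e M = int K"
    and frame: "\<And>k M xs ys x. J k M xs ys \<Longrightarrow> J k (M(v := x)) xs ys"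
    and step: "\<And>k M xs ys. k < K \<Longrightarrow> J k M xs ys \<Longrightarrow> M v = int k \<Longrightarrow>
      wp c (\<lambda>M xs ys. J (Suc k) M xs ys \<and> M v = int k) M xs ys"
    and fin: "\<And>M xs ys. J K M xs ys \<Longrightarrow> Q M xs ys"
    and "K \<le> N"
  shows "wp (For v e c) Q M xs ys"
proof -
  have N: "int k \<le> 2 ^ w" if "k \<le> K" for k
    using that \<open>K \<le> N\<close> N_le by linarith
  show ?thesis
    unfolding For_def
  proof (intro wp_Seq wp_Store, goal_cases)
    case 2
    show ?case
    proof (rule wp_While[where J = "\<lambda>k M xs ys. J k M xs ys \<and> M v = int k" and K = K], goal_cases)
      case 1
      show ?case using init frame by simp
    next
      case (2 k M xs ys)
      then show ?case using bound[of k M xs ys] by simp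
    next
      case (3 k M xs ys)
      then show ?case
        by (intro wp_Seq wp_mono[OF step[of k M xs ys]] wp_Store)
          (use frame N[of "Suc k"] in auto)
    qed (use fin \<open>K \<le> N\<close> in auto)
  qed simp
qed

end

section \<open>The dynamic program\<close>

definition improve :: "int \<Rightarrow> nat \<Rightarrow> int \<times> nat \<Rightarrow> int \<times> nat" where
  "improve x h p = (if x < fst p then (x, h) else p)"

lemma fst_improve: "fst (improve x h p) = min x (fst p)"
  unfolding improve_def by auto

locale degree_problem =
  fixes m n :: nat and f g :: "nat \<Rightarrow> nat \<Rightarrow> int"
begin

text \<open>Squares replace absolute values: an integer is at most its square in absolute value, and
  the machine accumulates squares without testing signs.\<close>

definition fsq :: "nat \<Rightarrow> int" where
  "fsq i = (\<Sum>k<n + 1. (f i k)\<^sup>2)"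

definition gsq :: "nat \<Rightarrow> int" where
  "gsq j = (\<Sum>k<m + 1. (g j k)\<^sup>2)"

definition total :: int where
  "total = (\<Sum>i<m. fsq i) + (\<Sum>j<n. gsq j)"

text \<open>Genuine costs lie between \<open>- total\<close> and \<open>total\<close>. A run that
  gives up after paying some of them still has value at least \<open>big - total\<close>, which is
  \<open>total + 1\<close>, so giving up is never optimal from the start.\<close>

definition big :: int where
  "big = 1 + 2 * total"

text \<open>Let \<open>\<rho>\<close> be the row sums and \<open>\<kappa>\<close> the conjugate of the column sums, that is, \<open>\<kappa> i\<close> is the
  number of columns whose sum exceeds \<open>i\<close>. The state \<open>(a, r, c, d)\<close> says that the first \<open>m - a\<close>
  entries of \<open>\<rho>\<close> and \<open>\<kappa>\<close> are chosen, that the remaining ones are at most \<open>r\<close> and \<open>c\<close>, respectively,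
  and that the chosen part of \<open>\<kappa>\<close> exceeds the chosen part of \<open>\<rho>\<close> by \<open>d\<close>. A column is paid for when
  \<open>c\<close> drops below it, as its sum is then \<open>m - a\<close>. The second component is the move to be made:
  1 and 2 decrement \<open>r\<close> and \<open>c\<close>, 3 chooses \<open>r\<close> and \<open>c\<close> as the next entries. Every state may also
  give up (move 0) at the prohibitive cost \<open>big\<close>.\<close>

function opt :: "nat \<Rightarrow> nat \<Rightarrow> nat \<Rightarrow> nat \<Rightarrow> int \<times> nat" where
  "opt a r c d =
    (let p0 = (if a = 0 \<and> r = 0 \<and> c = 0 \<and> d = 0 then 0 else big, 0);
       p1 = (if 0 < r then improve (fst (opt a (r - 1) c d)) 1 p0 else p0);
       p2 = (if 0 < c then improve (g (c - 1) (m - a) + fst (opt a r (c - 1) d)) 2 p1 else p1)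
     in if 0 < a \<and> r \<le> d + c
        then improve (f (m - a) r + fst (opt (a - 1) r c (d + c - r))) 3 p2 else p2)"
  by auto
termination
  by (relation "measure (\<lambda>(a, r, c, d). a + r + c)") auto

declare opt.simps [simp del]

lemma total_nonneg: "total \<ge> 0"
  unfolding total_def fsq_def gsq_def by (intro add_nonneg_nonneg sum_nonneg) auto

lemma big_nonneg: "big \<ge> 0"
  unfolding big_def using total_nonneg by simp

section \<open>Bellman inequalities and the recorded move\<close>

lemma opt_terminal: "fst (opt 0 0 0 0) \<le> 0"
  by (subst opt.simps) (simp add: Let_def)

lemma opt_le_dec_r: "0 < r \<Longrightarrow> fst (opt a r c d) \<le> fst (opt a (r - 1) c d)"
  by (subst opt.simps) (simp add: Let_def fst_improve min_le_iff_disj)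

lemma opt_le_dec_c: "0 < c \<Longrightarrow> fst (opt a r c d) \<le> g (c - 1) (m - a) + fst (opt a r (c - 1) d)"
  by (subst opt.simps) (simp add: Let_def fst_improve min_le_iff_disj)

lemma opt_le_commit: "0 < a \<Longrightarrow> r \<le> d + c \<Longrightarrow>
    fst (opt a r c d) \<le> f (m - a) r + fst (opt (a - 1) r c (d + c - r))"
  by (subst opt.simps) (simp add: Let_def fst_improve min_le_iff_disj)

text \<open>Converse of the inequalities above: the recorded move attains the recorded value, since
  \<open>improve\<close> either keeps its pair or replaces value and move together.\<close>

lemma opt_choice [case_names stop dec_r dec_c commit]:
  obtains (stop) "snd (opt a r c d) = 0"
      "fst (opt a r c d) = big \<or> a = 0 \<and> r = 0 \<and> c = 0 \<and> d = 0 \<and> fst (opt a r c d) = 0"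
  | (dec_r) "snd (opt a r c d) = 1" "0 < r" "fst (opt a r c d) = fst (opt a (r - 1) c d)"
  | (dec_c) "snd (opt a r c d) = 2" "0 < c"
      "fst (opt a r c d) = g (c - 1) (m - a) + fst (opt a r (c - 1) d)"
  | (commit) "snd (opt a r c d) = 3" "0 < a" "r \<le> d + c"
      "fst (opt a r c d) = f (m - a) r + fst (opt (a - 1) r c (d + c - r))"
proof -
  define p0 where "p0 = (if a = 0 \<and> r = 0 \<and> c = 0 \<and> d = 0 then 0 else big, 0 :: nat)"
  define p1 where "p1 = (if 0 < r then improve (fst (opt a (r - 1) c d)) 1 p0 else p0)"
  define p2 where
    "p2 = (if 0 < c then improve (g (c - 1) (m - a) + fst (opt a r (c - 1) d)) 2 p1 else p1)"
  have eq: "opt a r c d = (if 0 < a \<and> r \<le> d + c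
      then improve (f (m - a) r + fst (opt (a - 1) r c (d + c - r))) 3 p2 else p2)"
    unfolding p2_def p1_def p0_def by (subst opt.simps) (simp add: Let_def)
  have 1: "p1 = p0 \<or> p1 = (fst (opt a (r - 1) c d), 1) \<and> 0 < r"
    unfolding p1_def improve_def by simp
  have 2: "p2 = p1 \<or> p2 = (g (c - 1) (m - a) + fst (opt a r (c - 1) d), 2) \<and> 0 < c"
    unfolding p2_def improve_def by simp
  have "opt a r c d = p2 \<or>
      opt a r c d = (f (m - a) r + fst (opt (a - 1) r c (d + c - r)), 3) \<and> 0 < a \<and> r \<le> d + c"
    unfolding eq improve_def by simp
  then consider "opt a r c d = p0" | "opt a r c d = (fst (opt a (r - 1) c d), 1)" "0 < r"
    | "opt a r c d = (g (c - 1) (m - a) + fst (opt a r (c - 1) d), 2)" "0 < c"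
    | "opt a r c d = (f (m - a) r + fst (opt (a - 1) r c (d + c - r)), 3)" "0 < a" "r \<le> d + c"
    using 1 2 by metis
  then show thesis
  proof cases
    case 1
    show ?thesis
    proof (rule stop)
      show "snd (opt a r c d) = 0"
        unfolding 1 p0_def by simp
      show "fst (opt a r c d) = big \<or> a = 0 \<and> r = 0 \<and> c = 0 \<and> d = 0 \<and> fst (opt a r c d) = 0"
        unfolding 1 p0_def by simp
    qed
  next
    case 2
    show ?thesis by (rule dec_r) (use 2(2-) in \<open>simp_all only: 2(1) fst_conv snd_conv\<close>)
  next
    case 3
    show ?thesis by (rule dec_c) (use 3(2-) in \<open>simp_all only: 3(1) fst_conv snd_conv\<close>)
  next
    case 4
    show ?thesis by (rule commit) (use 4(2-) in \<open>simp_all only: 4(1) fst_conv snd_conv\<close>)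
  qed
qed

section \<open>Lower bounds for the values of the dynamic program\<close>

lemma abs_f_le: "k \<le> n \<Longrightarrow> \<bar>f i k\<bar> \<le> fsq i"
proof -
  assume "k \<le> n"
  then have "(f i k)\<^sup>2 \<le> fsq i"
    unfolding fsq_def by (intro member_le_sum) auto
  moreover have "\<bar>f i k\<bar> \<le> (f i k)\<^sup>2"
    using self_le_power[of "\<bar>f i k\<bar>" 2] by (cases "f i k = 0") auto
  ultimately show ?thesis by simp
qed

lemma abs_g_le: "k \<le> m \<Longrightarrow> \<bar>g j k\<bar> \<le> gsq j"
proof -
  assume "k \<le> m"
  then have "(g j k)\<^sup>2 \<le> gsq j"
    unfolding gsq_def by (intro member_le_sum) auto
  moreover have "\<bar>g j k\<bar> \<le> (g j k)\<^sup>2"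
    using self_le_power[of "\<bar>g j k\<bar>" 2] by (cases "g j k = 0") auto
  ultimately show ?thesis by simp
qed

lemma fsq_nonneg: "fsq i \<ge> 0" and gsq_nonneg: "gsq i \<ge> 0"
  unfolding fsq_def gsq_def by (rule sum_nonneg; simp)+

lemma sum_atLeast_diff_Suc:
  assumes "0 < a" "a \<le> (m :: nat)"
  shows "(\<Sum>k\<in>{m - a..<m}. h k) = h (m - a) + (\<Sum>k\<in>{m - (a - 1)..<m}. (h k :: int))"
proof -
  have "m - (a - 1) = Suc (m - a)" using assms by simp
  then show ?thesis using assms by (simp add: sum.atLeast_Suc_lessThan)
qed

lemma sum_lessThan_pred:
  assumes "0 < (c :: nat)"
  shows "(\<Sum>j<c. h j) = h (c - 1) + (\<Sum>j<c - 1. (h j :: int))"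
  using assms by (cases c) auto

text \<open>A continuation pays at most once for each remaining row and each column below
  \<open>c\<close>, and giving up costs a nonnegative amount.\<close>

lemma opt_ge:
  assumes "a \<le> m" "r \<le> n"
  shows "- (\<Sum>k\<in>{m - a..<m}. fsq k) - (\<Sum>j<c. gsq j) \<le> fst (opt a r c d)"
  using assms
proof (induction "a + r + c" arbitrary: a r c d rule: less_induct)
  case less
  show ?case
  proof (cases rule: opt_choice[of a r c d])
    case stop
    have "(\<Sum>k\<in>{m - a..<m}. fsq k) \<ge> 0" "(\<Sum>j<c. gsq j) \<ge> 0"
      by (auto intro!: sum_nonneg fsq_nonneg gsq_nonneg)
    then show ?thesis using stop(2) big_nonneg by linarith
  next
    case dec_r
    then show ?thesis using less(1)[of a "r - 1" c d] less.prems by simp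
  next
    case dec_c
    moreover have "\<bar>g (c - 1) (m - a)\<bar> \<le> gsq (c - 1)" by (rule abs_g_le) simp
    moreover have "- (\<Sum>k\<in>{m - a..<m}. fsq k) - (\<Sum>j<c - 1. gsq j) \<le> fst (opt a r (c - 1) d)"
      using less.prems dec_c by (intro less(1)) auto
    ultimately show ?thesis using sum_lessThan_pred[of c gsq] by linarith
  next
    case commit
    moreover have "\<bar>f (m - a) r\<bar> \<le> fsq (m - a)" by (rule abs_f_le) (use less.prems in simp)
    moreover have "- (\<Sum>k\<in>{m - (a - 1)..<m}. fsq k) - (\<Sum>j<c. gsq j)
        \<le> fst (opt (a - 1) r c (d + c - r))"
      using less.prems commit by (intro less(1)) auto
    ultimately show ?thesis using sum_atLeast_diff_Suc[of a fsq] less.prems by linarith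
  qed
qed

lemma opt_ge_total:
  assumes "a \<le> m" "r \<le> n" "c \<le> n"
  shows "- total \<le> fst (opt a r c d)"
proof -
  have "(\<Sum>k\<in>{m - a..<m}. fsq k) \<le> (\<Sum>k<m. fsq k)" "(\<Sum>j<c. gsq j) \<le> (\<Sum>j<n. gsq j)"
    using assms by (auto intro!: sum_mono2 fsq_nonneg gsq_nonneg)
  then show ?thesis using opt_ge[OF assms(1,2), of c d] unfolding total_def by linarith
qed

text \<open>The path of the pair \<open>(\<rho>, \<kappa>)\<close> through the states; \<open>\<gamma>\<close> is the conjugate of \<open>\<kappa>\<close>.\<close>

lemma opt_le_path:
  assumes \<rho>: "\<And>k. k < m \<Longrightarrow> \<rho> k \<le> n" "\<And>k l. k \<le> l \<Longrightarrow> l < m \<Longrightarrow> \<rho> l \<le> \<rho> k"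
    and \<gamma>: "\<And>j. j < n \<Longrightarrow> \<gamma> j \<le> m" "\<And>j l. j \<le> l \<Longrightarrow> l < n \<Longrightarrow> \<gamma> l \<le> \<gamma> j"
    and dom: "\<And>i. i \<le> m \<Longrightarrow> (\<Sum>k<i. \<rho> k) \<le> (\<Sum>j<n. min (\<gamma> j) i)"
    and eq: "(\<Sum>k<m. \<rho> k) = (\<Sum>j<n. \<gamma> j)"
    and "a \<le> m" "c \<le> n" "0 < a \<Longrightarrow> \<rho> (m - a) \<le> r"
    and "\<And>j. j < c \<Longrightarrow> m - a \<le> \<gamma> j" "\<And>j. c \<le> j \<Longrightarrow> j < n \<Longrightarrow> \<gamma> j \<le> m - a"
    and "d + (\<Sum>k<m - a. \<rho> k) = (\<Sum>j<n. min (\<gamma> j) (m - a))"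
  shows "fst (opt a r c d) \<le> (\<Sum>k\<in>{m - a..<m}. f k (\<rho> k)) + (\<Sum>j<c. g j (\<gamma> j))"
  using assms(7-)
proof (induction "a + r + c" arbitrary: a r c d rule: less_induct)
  case less
  \<comment> \<open>The schedule behind the path: pay for the columns whose sum is the number of
    chosen rows, then lower \<open>r\<close> to the next row sum, then commit.\<close>
  consider (col) "0 < c" "\<gamma> (c - 1) = m - a" | (row) "\<And>j. j < c \<Longrightarrow> m - a < \<gamma> j"
  proof (cases "0 < c \<and> \<gamma> (c - 1) = m - a")
    case False
    have "m - a < \<gamma> j" if "j < c" for j
    proof -
      have "\<gamma> (c - 1) \<le> \<gamma> j" using that less.prems(2) by (intro \<gamma>(2)) auto
      moreover have "m - a \<le> \<gamma> (c - 1)" using less.prems(4)[of "c - 1"] that by simp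
      ultimately show ?thesis using False that by fastforce
    qed
    then show ?thesis using row by blast
  qed (use col in blast)
  then show ?case
  proof cases
    case col
    have "\<gamma> j \<le> m - a" if "c - 1 \<le> j" "j < n" for j
      using less.prems(5)[of j] col that by (cases "j = c - 1") auto
    then have "fst (opt a r (c - 1) d)
        \<le> (\<Sum>k\<in>{m - a..<m}. f k (\<rho> k)) + (\<Sum>j<c - 1. g j (\<gamma> j))"
      using less.prems col by (intro less(1)) auto
    then show ?thesis
      using opt_le_dec_c[OF col(1), of a r d] sum_lessThan_pred[of c "\<lambda>j. g j (\<gamma> j)"] col by simp
  next
    case row
    show ?thesis
    proof (cases "0 < r \<and> (a = 0 \<or> \<rho> (m - a) < r)")
      case True
      then have "fst (opt a (r - 1) c d) \<le> (\<Sum>k\<in>{m - a..<m}. f k (\<rho> k)) + (\<Sum>j<c. g j (\<gamma> j))"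
        using less.prems by (intro less(1)) auto
      then show ?thesis using opt_le_dec_r[of r a c d] True by simp
    next
      case r: False
      show ?thesis
      proof (cases "a = 0")
        case True
        have "c = 0"
        proof (rule ccontr)
          assume "c \<noteq> 0"
          then show False using row[of 0] \<gamma>(1)[of 0] True less.prems(2) by simp
        qed
        moreover have "r = 0" using r True by simp
        moreover have "(\<Sum>j<n. min (\<gamma> j) m) = (\<Sum>j<n. \<gamma> j)"
          using \<gamma>(1) by (intro sum.cong) auto
        then have "d = 0" using less.prems(6) eq True by simp
        ultimately show ?thesis using True opt_terminal by simp
      next
        case False
        then have r: "r = \<rho> (m - a)" using r less.prems(3) by fastforce
        define i where "i = m - a"
        have i: "m - (a - 1) = Suc i" "i < m" using False less.prems(1) by (auto simp: i_def)
        \<comment> \<open>At this point the columns with sum above \<open>i\<close> are exactly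
          those below \<open>c\<close>, so \<open>c\<close> is the next entry of the
          conjugate.\<close>
        have "(\<Sum>j<n. min (\<gamma> j) (Suc i)) = (\<Sum>j<n. min (\<gamma> j) i + of_bool (j < c))"
        proof (intro sum.cong refl)
          fix j assume "j \<in> {..<n}"
          then show "min (\<gamma> j) (Suc i) = min (\<gamma> j) i + of_bool (j < c)"
            using row[of j] less.prems(5)[of j] by (cases "j < c") (auto simp: i_def)
        qed
        also have "\<dots> = (\<Sum>j<n. min (\<gamma> j) i) + c"
        proof -
          have "{j. j < n \<and> j < c} = {..<c}" using less.prems(2) by auto
          then show ?thesis by (simp add: sum.distrib Collect_conj_eq[symmetric] lessThan_def)
        qed
        finally have step: "(\<Sum>j<n. min (\<gamma> j) (Suc i)) = (\<Sum>j<n. min (\<gamma> j) i) + c" .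
        have d: "d + (\<Sum>k<i. \<rho> k) = (\<Sum>j<n. min (\<gamma> j) i)" using less.prems(6) by (simp add: i_def)
        have r': "r = \<rho> i" using r by (simp add: i_def)
        have le: "r \<le> d + c" using dom[of "Suc i"] step d r' i by simp
        have "fst (opt (a - 1) r c (d + c - r)) \<le>
            (\<Sum>k\<in>{m - (a - 1)..<m}. f k (\<rho> k)) + (\<Sum>j<c. g j (\<gamma> j))"
        proof (rule less(1))
          show "a - 1 + r + c < a + r + c" using False by simp
          show "a - 1 \<le> m" "c \<le> n" using less.prems by auto
          show "\<rho> (m - (a - 1)) \<le> r" if "0 < a - 1"
            unfolding i r' using that i by (intro \<rho>(2)) auto
          show "m - (a - 1) \<le> \<gamma> j" if "j < c" for j
            unfolding i using row[OF that] by (simp add: i_def)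
          show "\<gamma> j \<le> m - (a - 1)" if "c \<le> j" "j < n" for j
            unfolding i using less.prems(5)[OF that] by (simp add: i_def)
          show "d + c - r + (\<Sum>k<m - (a - 1). \<rho> k) = (\<Sum>j<n. min (\<gamma> j) (m - (a - 1)))"
            unfolding i step using d le r' by simp
        qed
        then show ?thesis
          using opt_le_commit[of a r d c] le False r less.prems(1)
            sum_atLeast_diff_Suc[of a "\<lambda>k. f k (\<rho> k)"] by simp
      qed
    qed
  qed
qed

section \<open>The optimal value as a lower bound for every monotone matrix\<close>

lemma opt_start_le:
  assumes \<rho>: "\<And>k. k < m \<Longrightarrow> \<rho> k \<le> n" "\<And>k l. k \<le> l \<Longrightarrow> l < m \<Longrightarrow> \<rho> l \<le> \<rho> k"
    and \<gamma>: "\<And>j. j < n \<Longrightarrow> \<gamma> j \<le> m" "\<And>j l. j \<le> l \<Longrightarrow> l < n \<Longrightarrow> \<gamma> l \<le> \<gamma> j"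
    and dom: "\<And>i. i \<le> m \<Longrightarrow> (\<Sum>k<i. \<rho> k) \<le> (\<Sum>j<n. min (\<gamma> j) i)"
    and eq: "(\<Sum>k<m. \<rho> k) = (\<Sum>j<n. \<gamma> j)"
  shows "fst (opt m n n 0) \<le> (\<Sum>k<m. f k (\<rho> k)) + (\<Sum>j<n. g j (\<gamma> j))"
proof -
  have "fst (opt m n n 0) \<le> (\<Sum>k\<in>{m - m..<m}. f k (\<rho> k)) + (\<Sum>j<n. g j (\<gamma> j))"
    by (rule opt_le_path[OF assms]) (use \<rho>(1) in simp_all)
  then show ?thesis by (simp add: atLeast0LessThan)
qed

text \<open>The zero matrix is always feasible; this caps the optimum and later excludes the give-up
  move.\<close>

lemma opt_start_le_total: "fst (opt m n n 0) \<le> total"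
proof -
  have "fst (opt m n n 0) \<le> (\<Sum>k<m. f k 0) + (\<Sum>j<n. g j 0)"
    by (rule opt_start_le) auto
  also have "\<dots> \<le> total"
    unfolding total_def using abs_f_le[of 0] abs_g_le[of 0]
    by (intro add_mono sum_mono) (auto intro: order_trans[OF abs_ge_self])
  finally show ?thesis .
qed

text \<open>Necessity in Gale-Ryser: the first \<open>i\<close> rows contain at most
  \<open>i\<close> ones of column \<open>j\<close>, and at most its whole sum.\<close>

lemma opt_start_le_cost:
  assumes B: "B \<in> monotone_01_mats m n"
  shows "fst (opt m n n 0) \<le> degree_cost f g B"
proof -
  have dim: "dim_row B = m" "dim_col B = n"
    using B by (auto simp: monotone_01_mats_def)
  have le: "B $$ (i, j) \<le> 1" if "i < m" "j < n" for i j
  proof -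
    have "B $$ (i, j) \<in> elements_mat B" using that dim by (intro elements_matI) auto
    then show ?thesis using B by (auto simp: monotone_01_mats_def)
  qed
  have mono: "antimono_on {..<m} (row_sum B)" "antimono_on {..<n} (col_sum B)"
    using B dim by (auto simp: monotone_01_mats_def monotone_mat_def)
  have "fst (opt m n n 0) \<le> (\<Sum>k<m. f k (row_sum B k)) + (\<Sum>j<n. g j (col_sum B j))"
  proof (rule opt_start_le)
    show "row_sum B k \<le> n" if "k < m" for k
      unfolding row_sum_def dim using sum_bounded_above[of "{..<n}" "\<lambda>j. B $$ (k, j)" 1] le that
      by simp
    show "col_sum B k \<le> m" if "k < n" for k
      unfolding col_sum_def dim using sum_bounded_above[of "{..<m}" "\<lambda>j. B $$ (j, k)" 1] le that
      by simp
    show "row_sum B l \<le> row_sum B k" if "k \<le> l" "l < m" for k l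
      using mono(1) that by (auto simp: monotone_on_def)
    show "col_sum B l \<le> col_sum B k" if "k \<le> l" "l < n" for k l
      using mono(2) that by (auto simp: monotone_on_def)
    show "(\<Sum>k<m. row_sum B k) = (\<Sum>j<n. col_sum B j)"
      unfolding row_sum_def col_sum_def dim by (rule sum.swap)
    show "(\<Sum>k<i. row_sum B k) \<le> (\<Sum>j<n. min (col_sum B j) i)" if "i \<le> m" for i
    proof -
      have "(\<Sum>k<i. row_sum B k) = (\<Sum>j<n. \<Sum>k<i. B $$ (k, j))"
        unfolding row_sum_def dim by (rule sum.swap)
      also have "\<dots> \<le> (\<Sum>j<n. min (col_sum B j) i)"
      proof (intro sum_mono min.boundedI)
        fix j assume j: "j \<in> {..<n}"
        show "(\<Sum>k<i. B $$ (k, j)) \<le> col_sum B j"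
          unfolding col_sum_def dim using that by (intro sum_mono2) auto
        show "(\<Sum>k<i. B $$ (k, j)) \<le> i"
          using sum_bounded_above[of "{..<i}" "\<lambda>k. B $$ (k, j)" 1] le that j by simp
      qed
      finally show ?thesis .
    qed
  qed
  then show ?thesis by (simp add: degree_cost_def dim)
qed

section \<open>Following the optimal moves\<close>

text \<open>Column sums of the Ferrers matrix whose first \<open>i\<close> rows have lengths
  \<open>\<kappa> k\<close>, that is, a conjugate partition.\<close>

definition col_count :: "nat \<Rightarrow> (nat \<Rightarrow> nat) \<Rightarrow> nat \<Rightarrow> nat" where
  "col_count i \<kappa> j = (\<Sum>k<i. of_bool (j < \<kappa> k))"

lemma col_count_antimono: "j \<le> l \<Longrightarrow> col_count i \<kappa> l \<le> col_count i \<kappa> j"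
  unfolding col_count_def by (intro sum_mono) auto

text \<open>The last conjunct is a conservation law: the cost paid so far plus the optimal cost to
  go is the initial optimum. Columns from \<open>c\<close> on have their final sums, since all
  further entries of \<kappa> are at most \<open>c\<close>.\<close>

definition trace_inv ::
    "nat \<Rightarrow> nat \<Rightarrow> nat \<Rightarrow> nat \<Rightarrow> (nat \<Rightarrow> nat) \<Rightarrow> (nat \<Rightarrow> nat) \<Rightarrow> bool" where
  "trace_inv a r c d \<rho> \<kappa> \<longleftrightarrow> a \<le> m \<and> r \<le> n \<and> c \<le> n \<and>
     (\<forall>k<m - a. r \<le> \<rho> k \<and> \<rho> k \<le> n \<and> c \<le> \<kappa> k \<and> \<kappa> k \<le> n) \<and>
     (\<forall>k l. k \<le> l \<longrightarrow> l < m - a \<longrightarrow> \<rho> l \<le> \<rho> k) \<and>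
     (\<forall>q\<le>m - a. (\<Sum>k<q. \<rho> k) \<le> (\<Sum>k<q. \<kappa> k)) \<and>
     d + (\<Sum>k<m - a. \<rho> k) = (\<Sum>k<m - a. \<kappa> k) \<and>
     fst (opt a r c d) + (\<Sum>k<m - a. f k (\<rho> k)) + (\<Sum>j\<in>{c..<n}. g j (col_count (m - a) \<kappa> j)) =
       fst (opt m n n 0)"

lemma trace_inv_init: "trace_inv m n n 0 \<rho> \<kappa>"
  unfolding trace_inv_def by simp

text \<open>Keeps the traced state inside the tabulated range.\<close>

lemma trace_inv_d_le:
  assumes "trace_inv a r c d \<rho> \<kappa>"
  shows "d \<le> (m - a) * n"
proof -
  have "d \<le> (\<Sum>k<m - a. \<kappa> k)" using assms unfolding trace_inv_def by linarith
  also have "\<dots> \<le> (m - a) * n"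
    using sum_bounded_above[of "{..<m - a}" \<kappa> n] assms unfolding trace_inv_def by simp
  finally show ?thesis .
qed

lemma trace_inv_dec_r:
  assumes "trace_inv a r c d \<rho> \<kappa>" "0 < r" "fst (opt a r c d) = fst (opt a (r - 1) c d)"
  shows "trace_inv a (r - 1) c d \<rho> \<kappa>"
proof -
  note inv = assms(1)[unfolded trace_inv_def assms(3)]
  have "r - 1 \<le> n" using inv by linarith
  moreover have "\<forall>k<m - a. r - 1 \<le> \<rho> k \<and> \<rho> k \<le> n \<and> c \<le> \<kappa> k \<and> \<kappa> k \<le> n"
    using inv by (meson le_trans[OF diff_le_self])
  ultimately show ?thesis
    unfolding trace_inv_def by - (insert inv, elim conjE, intro conjI; assumption)
qed

lemma trace_inv_dec_c:
  assumes "trace_inv a r c d \<rho> \<kappa>" "0 < c"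
    "fst (opt a r c d) = g (c - 1) (m - a) + fst (opt a r (c - 1) d)"
  shows "trace_inv a r (c - 1) d \<rho> \<kappa>"
proof -
  have le: "c \<le> \<kappa> k" if "k < m - a" for k using that assms(1) unfolding trace_inv_def by blast
  \<comment> \<open>Every chosen row has length at least \<open>c\<close>, so column
    \<open>c - 1\<close> meets all \<open>m - a\<close> of them and \<open>g (c - 1) (m - a)\<close>
    is its true cost.\<close>
  have "(\<Sum>k<m - a. of_bool (c - 1 < \<kappa> k)) = (\<Sum>k<m - a. 1 :: nat)"
    using le assms(2) by (intro sum.cong) fastforce+
  then have "col_count (m - a) \<kappa> (c - 1) = m - a"
    unfolding col_count_def by simp
  moreover have "{c - 1..<n} = insert (c - 1) {c..<n}"
    using assms(1,2) unfolding trace_inv_def by auto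
  ultimately have cost: "(\<Sum>j\<in>{c - 1..<n}. g j (col_count (m - a) \<kappa> j)) =
      g (c - 1) (m - a) + (\<Sum>j\<in>{c..<n}. g j (col_count (m - a) \<kappa> j))"
    using assms(2) by simp
  note inv = assms(1)[unfolded trace_inv_def]
  have "c - 1 \<le> n" using inv by linarith
  moreover have "\<forall>k<m - a. r \<le> \<rho> k \<and> \<rho> k \<le> n \<and> c - 1 \<le> \<kappa> k \<and> \<kappa> k \<le> n"
    using inv by (meson le_trans[OF diff_le_self])
  moreover have "fst (opt a r (c - 1) d) + (\<Sum>k<m - a. f k (\<rho> k)) +
      (\<Sum>j\<in>{c - 1..<n}. g j (col_count (m - a) \<kappa> j)) = fst (opt m n n 0)"
    using inv cost assms(3) by linarith
  ultimately show ?thesis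
    unfolding trace_inv_def by - (insert inv, elim conjE, intro conjI; assumption)
qed

lemma trace_inv_commit:
  assumes inv: "trace_inv a r c d \<rho> \<kappa>" and "0 < a" and le: "r \<le> d + c"
    and opt: "fst (opt a r c d) = f (m - a) r + fst (opt (a - 1) r c (d + c - r))"
  shows "trace_inv (a - 1) r c (d + c - r) (\<rho>(m - a := r)) (\<kappa>(m - a := c))"
proof -
  define i where "i = m - a"
  have i: "m - (a - 1) = Suc i" using assms(2) inv unfolding trace_inv_def i_def by auto
  have upd: "(\<Sum>k<q. h ((\<sigma>(i := x)) k)) = (\<Sum>k<q. h (\<sigma> k))" if "q \<le> i"
    for q \<sigma> x and h :: "nat \<Rightarrow> nat"
    using that by (intro sum.cong) auto
  have upd_f: "(\<Sum>k<i. f k ((\<rho>(i := r)) k)) = (\<Sum>k<i. f k (\<rho> k))"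
    by (intro sum.cong) auto
  \<comment> \<open>The new row has length \<open>c\<close> and adds nothing to the columns from
    \<open>c\<close> on, so costs already paid stay valid.\<close>
  have upd_g: "(\<Sum>j\<in>{c..<n}. g j (col_count (Suc i) (\<kappa>(i := c)) j)) =
      (\<Sum>j\<in>{c..<n}. g j (col_count i \<kappa> j))"
  proof (intro sum.cong refl)
    fix j assume "j \<in> {c..<n}"
    moreover have "(\<Sum>k<i. of_bool (j < (\<kappa>(i := c)) k)) = (\<Sum>k<i. of_bool (j < \<kappa> k) :: nat)"
      by (intro sum.cong) auto
    ultimately show "g j (col_count (Suc i) (\<kappa>(i := c)) j) = g j (col_count i \<kappa> j)"
      by (simp add: col_count_def del: sum_of_bool_eq)
  qed
  show ?thesis
    unfolding trace_inv_def i i_def[symmetric]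
  proof (intro conjI allI impI)
    note inv' = inv[unfolded trace_inv_def i_def[symmetric]]
    show "a - 1 \<le> m" "r \<le> n" "c \<le> n" using inv' by auto
    fix k
    assume "k < Suc i"
    then show "r \<le> (\<rho>(i := r)) k" "(\<rho>(i := r)) k \<le> n" "c \<le> (\<kappa>(i := c)) k" "(\<kappa>(i := c)) k \<le> n"
      using inv' by (cases "k = i"; auto)+
  next
    fix k l assume "k \<le> l" "l < Suc i"
    then show "(\<rho>(i := r)) l \<le> (\<rho>(i := r)) k"
      using inv unfolding trace_inv_def i_def[symmetric] by (cases "k = i"; cases "l = i"; auto)
  next
    note inv' = inv[unfolded trace_inv_def i_def[symmetric]]
    fix q assume "q \<le> Suc i"
    then consider "q \<le> i" | "q = Suc i" by linarith
    then show "(\<Sum>k<q. (\<rho>(i := r)) k) \<le> (\<Sum>k<q. (\<kappa>(i := c)) k)"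
      using upd[where h = "\<lambda>x. x"] inv' le by cases auto
  next
    note inv' = inv[unfolded trace_inv_def i_def[symmetric]]
    show "d + c - r + (\<Sum>k<Suc i. (\<rho>(i := r)) k) = (\<Sum>k<Suc i. (\<kappa>(i := c)) k)"
      using upd[of i "\<lambda>x. x"] inv' le by simp
    show "fst (opt (a - 1) r c (d + c - r)) + (\<Sum>k<Suc i. f k ((\<rho>(i := r)) k)) +
        (\<Sum>j = c..<n. g j (col_count (Suc i) (\<kappa>(i := c)) j)) = fst (opt m n n 0)"
      using upd_f upd_g inv' opt by (simp add: i_def)
  qed
qed

lemma trace_inv_not_big:
  assumes inv: "trace_inv a r c d \<rho> \<kappa>"
  shows "fst (opt a r c d) \<noteq> big"
proof
  assume big: "fst (opt a r c d) = big"
  have "- (\<Sum>k<m. fsq k) \<le> - (\<Sum>k<m - a. fsq k)"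
    by (auto intro!: sum_mono2 fsq_nonneg)
  also have "\<dots> \<le> (\<Sum>k<m - a. f k (\<rho> k))"
    unfolding sum_negf[symmetric]
  proof (rule sum_mono)
    fix k assume "k \<in> {..<m - a}"
    then have "\<rho> k \<le> n" using inv unfolding trace_inv_def by blast
    then show "- fsq k \<le> f k (\<rho> k)" using abs_f_le[of "\<rho> k" k] by linarith
  qed
  finally have 1: "- (\<Sum>k<m. fsq k) \<le> (\<Sum>k<m - a. f k (\<rho> k))" .
  have cnt: "col_count (m - a) \<kappa> j \<le> m" for j
  proof -
    have "col_count (m - a) \<kappa> j \<le> (\<Sum>k<m - a. 1)"
      unfolding col_count_def by (intro sum_mono) auto
    then show ?thesis by simp
  qed
  have "- (\<Sum>j<n. gsq j) \<le> - (\<Sum>j\<in>{c..<n}. gsq j)"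
    by (auto intro!: sum_mono2 gsq_nonneg)
  also have "\<dots> \<le> (\<Sum>j\<in>{c..<n}. g j (col_count (m - a) \<kappa> j))"
    unfolding sum_negf[symmetric]
  proof (rule sum_mono)
    fix j
    show "- gsq j \<le> g j (col_count (m - a) \<kappa> j)" using abs_g_le[OF cnt, of j j] by linarith
  qed
  finally have "big - total \<le> fst (opt m n n 0)"
    using inv big 1 unfolding trace_inv_def total_def by linarith
  then show False using opt_start_le_total total_nonneg unfolding big_def by linarith
qed

lemma trace_inv_stop:
  assumes "trace_inv a r c d \<rho> \<kappa>" "snd (opt a r c d) = 0"
  shows "a = 0 \<and> r = 0 \<and> c = 0 \<and> d = 0 \<and> fst (opt a r c d) = 0"
  using assms trace_inv_not_big[OF assms(1)] by (cases rule: opt_choice[of a r c d]) auto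

section \<open>From the Ferrers matrix to the prescribed row sums\<close>

definition excess :: "(nat \<Rightarrow> nat) \<Rightarrow> (nat \<Rightarrow> nat \<Rightarrow> nat) \<Rightarrow> nat \<Rightarrow> int" where
  "excess \<rho> A k = int (\<Sum>j<n. A k j) - int (\<rho> k)"

text \<open>Rows before \<open>q\<close> are not in deficit; while row \<open>q\<close> is, the rows
  before \<open>p\<close> have no surplus left to give. Only prefix sums reaching \<open>q\<close>
  are kept, because a transfer from an earlier row to \<open>q\<close> changes some shorter
  ones.\<close>

definition repair_inv ::
    "(nat \<Rightarrow> nat) \<Rightarrow> (nat \<Rightarrow> nat) \<Rightarrow> nat \<Rightarrow> nat \<Rightarrow> (nat \<Rightarrow> nat \<Rightarrow> nat) \<Rightarrow> bool" where
  "repair_inv \<rho> \<gamma> q p A \<longleftrightarrow> (\<forall>k<m. \<forall>j<n. A k j \<le> 1) \<and> (\<forall>j<n. (\<Sum>k<m. A k j) = \<gamma> j) \<and>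
     (\<forall>k<q. 0 \<le> excess \<rho> A k) \<and> (excess \<rho> A q < 0 \<longrightarrow> (\<forall>k<p. excess \<rho> A k = 0)) \<and>
     (\<forall>q'. q \<le> q' \<longrightarrow> q' < m \<longrightarrow> 0 \<le> (\<Sum>k<Suc q'. excess \<rho> A k)) \<and> (\<Sum>k<m. excess \<rho> A k) = 0"

definition transfer :: "nat \<Rightarrow> nat \<Rightarrow> nat \<Rightarrow> (nat \<Rightarrow> nat \<Rightarrow> nat) \<Rightarrow> nat \<Rightarrow> nat \<Rightarrow> nat" where
  "transfer p q j A = A(p := (A p)(j := 0), q := (A q)(j := 1))"

lemma excess_transfer:
  assumes "p \<noteq> q" "j < n" "A p j = 1" "A q j = 0"
  shows "excess \<rho> (transfer p q j A) =
    (excess \<rho> A)(p := excess \<rho> A p - 1, q := excess \<rho> A q + 1)"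
proof -
  have "(\<Sum>l<n. A p l) = Suc (\<Sum>l<n. ((A p)(j := 0)) l)"
    using assms by (subst (1 2) sum.remove[of _ j]) (auto intro!: sum.cong)
  moreover have "(\<Sum>l<n. ((A q)(j := 1)) l) = Suc (\<Sum>l<n. A q l)"
    using assms by (subst (1 2) sum.remove[of _ j]) (auto intro!: sum.cong)
  ultimately show ?thesis
    using assms(1) by (auto simp: excess_def transfer_def fun_eq_iff simp del: of_nat_sum)
qed

lemma sum_move:
  fixes h :: "nat \<Rightarrow> int"
  assumes "p \<noteq> q" "p < x" "q < x"
  shows "(\<Sum>k<x. (h(p := h p - 1, q := h q + 1)) k) = (\<Sum>k<x. h k)"
proof -
  have "(\<Sum>k<x. (h(p := h p - 1, q := h q + 1)) k)
      = (\<Sum>k<x. h k + (if k = q then 1 else 0) - (if k = p then 1 else 0))"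
    using assms by (intro sum.cong) auto
  also have "\<dots> = (\<Sum>k<x. h k)"
    using assms by (simp add: sum.distrib sum_subtractf)
  finally show ?thesis .
qed

lemma repair_inv_transfer:
  assumes inv: "repair_inv \<rho> \<gamma> q p A" and "p < q" "q < m" and j: "j < n"
    and Aj: "A p j = 1" "A q j = 0" and ex: "excess \<rho> A p > 0" "excess \<rho> A q < 0"
  shows "repair_inv \<rho> \<gamma> q p (transfer p q j A)"
proof -
  have pq: "p \<noteq> q" "p < m" using assms by auto
  note et = excess_transfer[of p q j A \<rho>, OF pq(1) j Aj]
  \<comment> \<open>A prefix that contains row \<open>q\<close> contains row \<open>p\<close> as
    well, so the two changes cancel.\<close>
  have s: "(\<Sum>k<x. excess \<rho> (transfer p q j A) k) = (\<Sum>k<x. excess \<rho> A k)" if "q < x" for x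
    unfolding et using that \<open>p < q\<close> by (intro sum_move) auto
  have col: "(\<Sum>k<m. transfer p q j A k l) = (\<Sum>k<m. A k l)" for l
  proof (cases "l = j")
    case True
    \<comment> \<open>Column \<open>j\<close> undergoes the same change by minus and plus one as the
      excesses, so \<open>sum_move\<close> applies again over the integers.\<close>
    have "int (\<Sum>k<m. transfer p q j A k j) =
      (\<Sum>k<m. ((\<lambda>k. int (A k j))(p := int (A p j) - 1, q := int (A q j) + 1)) k)"
      unfolding of_nat_sum using Aj pq by (intro sum.cong) (auto simp: transfer_def)
    also have "\<dots> = int (\<Sum>k<m. A k j)"
      using sum_move[of p q m "\<lambda>k. int (A k j)"] pq \<open>q < m\<close> by simp
    finally show ?thesis unfolding True of_nat_eq_iff .
  next
    case False
    then show ?thesis by (intro sum.cong) (auto simp: transfer_def)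
  qed
  show ?thesis
    unfolding repair_inv_def col
  proof (intro conjI allI impI)
    show "transfer p q j A k l \<le> 1" if "k < m" "l < n" for k l
      using inv that unfolding repair_inv_def transfer_def by auto
    show "(\<Sum>k<m. A k l) = \<gamma> l" if "l < n" for l
      using inv that unfolding repair_inv_def by simp
    show "0 \<le> excess \<rho> (transfer p q j A) k" if "k < q" for k
      unfolding et using inv that ex unfolding repair_inv_def by auto
    show "excess \<rho> (transfer p q j A) k = 0" if "k < p" for k
      unfolding et using inv that ex \<open>p < q\<close> unfolding repair_inv_def by auto
    show "0 \<le> (\<Sum>k<Suc q'. excess \<rho> (transfer p q j A) k)" if "q \<le> q'" "q' < m" for q'
      using inv that s[of "Suc q'"] unfolding repair_inv_def by simp
    show "(\<Sum>k<m. excess \<rho> (transfer p q j A) k) = 0"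
      using inv s[of m] \<open>q < m\<close> unfolding repair_inv_def by simp
  qed
qed

text \<open>A surplus in row \<open>p\<close> and a deficit in row \<open>q\<close> force row
  \<open>p\<close> to have more ones than row \<open>q\<close>, which an entrywise comparison rules
  out. A full scan of the columns thus leaves no surplus in \<open>p\<close> or no deficit in
  \<open>q\<close>.\<close>

lemma repair_inv_next_row:
  assumes inv: "repair_inv \<rho> \<gamma> q p A" and "p < q" "\<rho> q \<le> \<rho> p"
    and le: "excess \<rho> A p > 0 \<Longrightarrow> excess \<rho> A q < 0 \<Longrightarrow> \<forall>j<n. A p j \<le> A q j"
  shows "repair_inv \<rho> \<gamma> q (Suc p) A"
proof -
  have "excess \<rho> A p = 0" if "excess \<rho> A q < 0"
  proof (rule ccontr)
    assume "excess \<rho> A p \<noteq> 0"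
    then have ex: "excess \<rho> A p > 0" using inv \<open>p < q\<close> unfolding repair_inv_def by force
    then have "(\<Sum>j<n. A p j) \<le> (\<Sum>j<n. A q j)" using le that by (intro sum_mono) auto
    then show False using that ex \<open>\<rho> q \<le> \<rho> p\<close> unfolding excess_def by linarith
  qed
  then show ?thesis using inv unfolding repair_inv_def by (auto simp: less_Suc_eq)
qed

text \<open>If row \<open>q\<close> were still in deficit, all earlier excesses would be zero and
  the prefix sum through \<open>q\<close> negative, against dominance.\<close>

lemma repair_inv_next:
  assumes inv: "repair_inv \<rho> \<gamma> q q A" and "q < m"
  shows "repair_inv \<rho> \<gamma> (Suc q) 0 A"
proof -
  have "excess \<rho> A q \<ge> 0"
  proof (rule ccontr)
    assume "\<not> ?thesis"
    then have "excess \<rho> A q < 0" "\<forall>k<q. excess \<rho> A k = 0"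
      using inv unfolding repair_inv_def by auto
    then have "(\<Sum>k<Suc q. excess \<rho> A k) < 0" by simp
    then show False using inv \<open>q < m\<close> unfolding repair_inv_def by fastforce
  qed
  then show ?thesis using inv unfolding repair_inv_def by (auto simp: less_Suc_eq)
qed

text \<open>Nonnegative excesses with sum zero all vanish.\<close>

lemma repair_inv_final:
  assumes inv: "repair_inv \<rho> \<gamma> m p A" and "k < m"
  shows "(\<Sum>j<n. A k j) = \<rho> k"
proof -
  have "\<forall>k\<in>{..<m}. excess \<rho> A k = 0"
    using inv sum_nonneg_eq_0_iff[of "{..<m}" "excess \<rho> A"] unfolding repair_inv_def by auto
  then show ?thesis using \<open>k < m\<close> by (simp add: excess_def del: of_nat_sum)
qed

text \<open>In the Ferrers matrix row \<open>k\<close> has excess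
  \<open>\<kappa> k - \<rho> k\<close>, so dominance becomes nonnegativity of the prefix sums of the
  excess.\<close>

lemma repair_inv_init:
  assumes "trace_inv 0 r c 0 \<rho> \<kappa>"
  shows "repair_inv \<rho> (col_count m \<kappa>) 0 0 (\<lambda>k j. of_bool (j < \<kappa> k))"
proof -
  have "excess \<rho> (\<lambda>k j. of_bool (j < \<kappa> k)) k = int (\<kappa> k) - int (\<rho> k)" if "k < m" for k
  proof -
    have "{j. j < n \<and> j < \<kappa> k} = {..<\<kappa> k}"
      using assms that unfolding trace_inv_def by fastforce
    then show ?thesis
      by (simp add: excess_def Collect_conj_eq[symmetric] lessThan_def)
  qed
  then have s: "(\<Sum>k<x. excess \<rho> (\<lambda>k j. of_bool (j < \<kappa> k)) k) =
      int (\<Sum>k<x. \<kappa> k) - int (\<Sum>k<x. \<rho> k)" if "x \<le> m" for x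
    using that by (simp add: sum_subtractf)
  have dom: "(\<Sum>k<x. \<rho> k) \<le> (\<Sum>k<x. \<kappa> k)" if "x \<le> m" for x
    using assms that unfolding trace_inv_def by simp
  have eq: "(\<Sum>k<m. \<rho> k) = (\<Sum>k<m. \<kappa> k)"
    using assms unfolding trace_inv_def by simp
  show ?thesis
    unfolding repair_inv_def
  proof (intro conjI allI impI)
    show "0 \<le> (\<Sum>k<Suc q'. excess \<rho> (\<lambda>k j. of_bool (j < \<kappa> k)) k)" if "q' < m" for q'
      using s[of "Suc q'"] dom[of "Suc q'"] that by (simp del: of_nat_sum sum.lessThan_Suc)
  qed (use s[of m] eq in \<open>auto simp: col_count_def\<close>)
qed

text \<open>By the conservation law the cost of the matrix is the optimum of the dynamic program,
  and no monotone matrix is cheaper than that.\<close>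

lemma final_mat:
  assumes tr: "trace_inv 0 0 0 0 \<rho> \<kappa>" "fst (opt 0 0 0 0) = 0"
    and A: "repair_inv \<rho> (col_count m \<kappa>) m p A"
  shows "is_arg_min (degree_cost f g) (\<lambda>B. B \<in> monotone_01_mats m n) (mat m n (\<lambda>(i, j). A i j))"
    (is "is_arg_min _ _ ?A")
proof -
  have rows: "row_sum ?A i = \<rho> i" if "i < m" for i
    using repair_inv_final[OF A that] that by (simp add: row_sum_def)
  have cols: "col_sum ?A j = col_count m \<kappa> j" if "j < n" for j
    using A that by (simp add: col_sum_def repair_inv_def)
  have "A i j \<in> {0, 1}" if "i < m" "j < n" for i j
  proof -
    have "A i j \<le> 1" using A that unfolding repair_inv_def by blast
    then show ?thesis by auto
  qed
  then have "elements_mat ?A \<subseteq> {0, 1}" by (fastforce simp: elements_mat_def)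
  moreover have "antimono_on {..<m} (row_sum ?A)"
    using tr(1) by (auto simp: monotone_on_def rows trace_inv_def)
  moreover have "antimono_on {..<n} (col_sum ?A)"
    by (auto simp: monotone_on_def cols intro!: col_count_antimono)
  ultimately have mem: "?A \<in> monotone_01_mats m n"
    by (simp add: monotone_01_mats_def monotone_mat_def)
  have "degree_cost f g ?A = (\<Sum>k<m. f k (\<rho> k)) + (\<Sum>j<n. g j (col_count m \<kappa> j))"
    by (simp add: degree_cost_def rows cols)
  also have "\<dots> = fst (opt m n n 0)"
    using tr unfolding trace_inv_def by (simp add: atLeast0LessThan)
  finally show ?thesis
    using mem opt_start_le_cost unfolding is_arg_min_def by fastforce
qed

end

section \<open>Memory layout\<close>

text \<open>Registers below 16 are scalars; the arrays are interleaved above them. A polynomial pairing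
  serves as index of multidimensional arrays, since it is injective without any bounds.\<close>

definition pair :: "nat \<Rightarrow> nat \<Rightarrow> nat" where
  "pair a b = (a + b)\<^sup>2 + a"

definition adr :: "nat \<Rightarrow> nat \<Rightarrow> nat" where
  "adr k x = 16 * x + 16 + k"

definition pair_expr :: "expr \<Rightarrow> expr \<Rightarrow> expr" where
  "pair_expr a b = Add (Mult (Add a b) (Add a b)) a"

definition cell :: "nat \<Rightarrow> expr \<Rightarrow> expr" where
  "cell k e = Add (Mult (Const 16) e) (Const (16 + int k))"

abbreviation node :: "nat \<Rightarrow> nat \<Rightarrow> nat \<Rightarrow> nat \<Rightarrow> nat" where
  "node a r c d \<equiv> pair (pair a r) (pair c d)"

abbreviation node_expr :: "expr \<Rightarrow> expr \<Rightarrow> expr \<Rightarrow> expr \<Rightarrow> expr" where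
  "node_expr a r c d \<equiv> pair_expr (pair_expr a r) (pair_expr c d)"

text \<open>\<open>pair a b\<close> is at least the square of \<open>a + b\<close> and less than the
  next square, so it determines \<open>a + b\<close> and then \<open>a\<close>.\<close>

lemma pair_eq_iff [simp]: "pair a b = pair a' b' \<longleftrightarrow> a = a' \<and> b = b'"
proof
  have less: "pair a b < pair a' b'" if "a + b < a' + b'" for a b a' b'
  proof -
    have "pair a b < (Suc (a + b))\<^sup>2" unfolding pair_def by (simp add: power2_eq_square)
    also have "\<dots> \<le> (a' + b')\<^sup>2" using that by (intro power_mono) auto
    also have "\<dots> \<le> pair a' b'" unfolding pair_def by simp
    finally show ?thesis .
  qed
  assume eq: "pair a b = pair a' b'"
  then have "a + b = a' + b'" using less[of a b a' b'] less[of a' b' a b] by linarith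
  moreover from this have "a = a'" using eq unfolding pair_def by (metis add_left_cancel)
  ultimately show "a = a' \<and> b = b'" by simp
qed simp

lemma adr_eq_iff [simp]: "k < 16 \<Longrightarrow> k' < 16 \<Longrightarrow> adr k x = adr k' x' \<longleftrightarrow> k = k' \<and> x = x'"
proof
  assume "k < 16" "k' < 16" "adr k x = adr k' x'"
  then have "16 * x + k = 16 * x' + k'" "k < 16" "k' < 16" unfolding adr_def by simp_all
  then have "(16 * x + k) div 16 = (16 * x' + k') div 16" "(16 * x + k) mod 16 = (16 * x' +
      k') mod 16"
    by simp_all
  then show "k = k' \<and> x = x'" using \<open>k < 16\<close> \<open>k' < 16\<close> by simp
qed simp

lemma adr_neq_scalar [simp]: "v < 16 \<Longrightarrow> adr k x \<noteq> v" "v < 16 \<Longrightarrow> v \<noteq> adr k x"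
  unfolding adr_def by auto

lemma scalar_notin_range_adr [simp]: "v < 16 \<Longrightarrow> v \<notin> range (adr k)"
  by (simp add: image_iff)

lemma adr_in_range_adr [simp]: "k < 16 \<Longrightarrow> k' < 16 \<Longrightarrow> adr k x \<in> range (adr k') \<longleftrightarrow> k = k'"
  by auto

lemma eval_pair: "eval a M = int x \<Longrightarrow> eval b M = int y \<Longrightarrow> eval (pair_expr a b) M = int (pair x y)"
  unfolding pair_expr_def pair_def by (simp add: power2_eq_square)

lemma eval_cell: "eval e M = int x \<Longrightarrow> nat (eval (cell k e) M) = adr k x"
  unfolding cell_def adr_def by simp

definition seqs :: "com list \<Rightarrow> com" where
  "seqs cs = foldr Seq cs Skip"

lemma seqs_simps [simp]: "seqs [] = Skip" "seqs (c # cs) = Seq c (seqs cs)"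
  unfolding seqs_def by auto

abbreviation reg :: "nat \<Rightarrow> expr" where
  "reg v \<equiv> Reg (Const (int v))"

abbreviation assign :: "nat \<Rightarrow> expr \<Rightarrow> com" where
  "assign v e \<equiv> Store (Const (int v)) e"

section \<open>The program\<close>

text \<open>Registers 2, 3 and 4 hold \<open>m\<close>, \<open>n\<close> and \<open>big\<close>. The arrays 2 and 3 hold the values of \<open>f\<close> and
  \<open>g\<close>, the arrays 4 and 5 the two components of \<open>opt\<close>, the array 6 the excess of the rows, and the
  array 7 the matrix.\<close>

definition read_table :: "nat \<Rightarrow> expr \<Rightarrow> expr \<Rightarrow> com" where
  "read_table k er ec =
    For 5 er (For 6 ec (seqs
      [Read (cell k (pair_expr (reg 5) (reg 6))),
       assign 4 (Add (reg 4) (Mult (Const 2) (Mult (Reg (cell k (pair_expr (reg 5) (reg 6))))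
         (Reg (cell k (pair_expr (reg 5) (reg 6)))))))]))"

definition read_input :: com where
  "read_input = seqs
    [Read (Const 2), Read (Const 3), assign 4 (Const 1),
     read_table 2 (reg 2) (Add (reg 3) (Const 1)),
     read_table 3 (reg 3) (Add (reg 2) (Const 1))]"

definition try_move :: "nat \<Rightarrow> expr \<Rightarrow> com" where
  "try_move h e = Cond (Sub (reg 9) e) (seqs [assign 9 e, assign 10 (Const (int h))]) Skip"

text \<open>Tests ask for positivity, so for natural numbers \<open>1 - x\<close> tests whether
  \<open>x\<close> is zero and \<open>1 + y - x\<close> whether \<open>x\<close> is at most
  \<open>y\<close>.\<close>

definition fill_node :: com where
  "fill_node = seqs
    [assign 9 (reg 4), assign 10 (Const 0),
     Cond (Sub (Const 1) (Add (Add (reg 5) (reg 6)) (Add (reg 7) (reg 8)))) (assign 9 (Const 0))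
         Skip,
     Cond (reg 6) (try_move 1
       (Reg (cell 4 (node_expr (reg 5) (Sub (reg 6) (Const 1)) (reg 7) (reg 8))))) Skip,
     Cond (reg 7) (try_move 2
       (Add (Reg (cell 3 (pair_expr (Sub (reg 7) (Const 1)) (Sub (reg 2) (reg 5)))))
         (Reg (cell 4 (node_expr (reg 5) (reg 6) (Sub (reg 7) (Const 1)) (reg 8)))))) Skip,
     Cond (reg 5) (Cond (Sub (Add (Const 1) (Add (reg 8) (reg 7))) (reg 6)) (try_move 3
       (Add (Reg (cell 2 (pair_expr (Sub (reg 2) (reg 5)) (reg 6))))
         (Reg (cell 4 (node_expr (Sub (reg 5) (Const 1)) (reg 6) (reg 7)
           (Sub (Add (reg 8) (reg 7)) (reg 6))))))) Skip) Skip,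
     Store (cell 4 (node_expr (reg 5) (reg 6) (reg 7) (reg 8))) (reg 9),
     Store (cell 5 (node_expr (reg 5) (reg 6) (reg 7) (reg 8))) (reg 10)]"

text \<open>Each move leads to a lexicographically smaller quadruple, so ascending loops meet every
  successor before it is needed. The range of \<open>d\<close> ends at the largest excess that
  \<open>m - a\<close> rows of length at most \<open>n\<close> can produce.\<close>

definition fill_tables :: com where
  "fill_tables =
    For 5 (Add (reg 2) (Const 1)) (For 6 (Add (reg 3) (Const 1)) (For 7 (Add (reg 3) (Const 1))
      (For 8 (Add (Mult (Sub (reg 2) (reg 5)) (reg 3)) (Const 1)) fill_node)))"

text \<open>Register 5 is decremented last because the row index \<open>m - a\<close> in the array
  writes is computed from it.\<close>

definition follow_commit :: com where
  "follow_commit = seqs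
    [For 9 (reg 7) (Store (cell 7 (pair_expr (Sub (reg 2) (reg 5)) (reg 9))) (Const 1)),
     Store (cell 6 (Sub (reg 2) (reg 5))) (Sub (reg 7) (reg 6)),
     assign 8 (Sub (Add (reg 8) (reg 7)) (reg 6)),
     assign 5 (Sub (reg 5) (Const 1))]"

text \<open>Every move except stopping lowers \<open>a + r + c\<close> by one, so
  \<open>m + 2 * n\<close> rounds suffice; rounds after a stop leave the state as it is, which
  permits a fixed loop count.\<close>

definition follow_moves :: com where
  "follow_moves = seqs
    [assign 5 (reg 2), assign 6 (reg 3), assign 7 (reg 3), assign 8 (Const 0),
     For 11 (Add (reg 2) (Add (reg 3) (reg 3))) (seqs
       [assign 10 (Reg (cell 5 (node_expr (reg 5) (reg 6) (reg 7) (reg 8)))),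
        Cond (Sub (reg 10) (Const 2)) follow_commit
         (Cond (Sub (reg 10) (Const 1)) (assign 7 (Sub (reg 7) (Const 1)))
           (Cond (reg 10) (assign 6 (Sub (reg 6) (Const 1))) Skip))])]"

definition repair_entry :: com where
  "repair_entry =
    Cond (Reg (cell 6 (reg 6))) (Cond (Sub (Const 0) (Reg (cell 6 (reg 5))))
      (Cond (Reg (cell 7 (pair_expr (reg 6) (reg 7))))
        (Cond (Sub (Const 1) (Reg (cell 7 (pair_expr (reg 5) (reg 7)))))
          (seqs
            [Store (cell 7 (pair_expr (reg 6) (reg 7))) (Const 0),
             Store (cell 7 (pair_expr (reg 5) (reg 7))) (Const 1),
             Store (cell 6 (reg 6)) (Sub (Reg (cell 6 (reg 6))) (Const 1)),
             Store (cell 6 (reg 5)) (Add (Reg (cell 6 (reg 5))) (Const 1))])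
          Skip) Skip) Skip) Skip"

definition repair :: com where
  "repair = For 5 (reg 2) (For 6 (reg 5) (For 7 (reg 3) repair_entry))"

definition write_output :: com where
  "write_output = For 5 (reg 2) (For 6 (reg 3) (Write (Reg (cell 7 (pair_expr (reg 5) (reg 6))))))"

definition program :: com where
  "program = seqs [read_input, fill_tables, follow_moves, repair, write_output]"

section \<open>Correctness of the program\<close>

text \<open>The left side of \<open>N_ge\<close> is the number of integers in the input; for
  positive \<open>m\<close> and \<open>n\<close> it dominates every loop count. \<open>w_ge\<close>
  leaves room for the move codes.\<close>

locale degree_machine = degree_problem m n f g + machine w N for m n f g w N +
  assumes N_ge: "2 * m * n + m + n + 2 \<le> N"
    and w_ge: "w \<ge> 2"
    and big_le: "big \<le> 2 ^ w"
begin

lemma nat_le_w: "x \<le> N \<Longrightarrow> int x \<le> 2 ^ w"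
  using N_le by linarith

lemma four_le: "(4 :: int) \<le> 2 ^ w"
proof -
  have "(4 :: int) = 2 ^ 2" by simp
  also have "\<dots> \<le> 2 ^ w" by (rule power_increasing[OF w_ge]) simp
  finally show ?thesis .
qed

lemma mn_le: "m \<le> N" "n \<le> N" "m + 1 \<le> N" "n + 1 \<le> N" "m * n + 1 \<le> N"
proof -
  have "m * n + m * n + m + n + 2 \<le> N" using N_ge by (simp add: mult_2 add_mult_distrib)
  then show "m \<le> N" "n \<le> N" "m + 1 \<le> N" "n + 1 \<le> N" "m * n + 1 \<le> N" by linarith+
qed

lemma sum_le_N:
  assumes "m > 0" "n > 0"
  shows "m + n + n \<le> N"
proof -
  have "n \<le> m * n" using assms(1) by (cases m) simp_all
  moreover have "m * n + m * n + m + n + 2 \<le> N" using N_ge by (simp add: mult_2 add_mult_distrib)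
  ultimately show ?thesis by linarith
qed

section \<open>Reading the input\<close>

lemma wp_read_table:
  fixes h :: "nat \<Rightarrow> nat \<Rightarrow> int"
  assumes k: "k < 16"
    and rows: "\<And>M'. M' 2 = M 2 \<Longrightarrow> M' 3 = M 3 \<Longrightarrow> eval er M' = int R"
    and cols: "\<And>M'. M' 2 = M 2 \<Longrightarrow> M' 3 = M 3 \<Longrightarrow> eval ec M' = int C"
    and "R \<le> N" "C \<le> N"
    and b: "M 4 = b" "0 \<le> b" "b + 2 * (\<Sum>i<R. \<Sum>j<C. (h i j)\<^sup>2) \<le> 2 ^ w"
    and xs: "xs = concat (map (\<lambda>i. map (h i) [0..<C]) [0..<R]) @ zs"
    and Q: "\<And>M'. (\<forall>i<R. \<forall>j<C. M' (adr k (pair i j)) = h i j) \<Longrightarrow>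
      M' 4 = b + 2 * (\<Sum>i<R. \<Sum>j<C. (h i j)\<^sup>2) \<Longrightarrow>
      (\<forall>x. x \<notin> {4, 5, 6} \<union> range (adr k) \<longrightarrow> M' x = M x) \<Longrightarrow> Q M' zs ys"
  shows "wp (read_table k er ec) Q M xs ys"
proof -
  define frame where "frame M' \<longleftrightarrow> (\<forall>x. x \<notin> {4, 5, 6} \<union> range (adr k) \<longrightarrow> M' x = M x)" for M'
  have fr: "M' 2 = M 2" "M' 3 = M 3" if "frame M'" for M'
    using that k unfolding frame_def by auto
  have fr_upd: "frame (M'(v := x))" if "frame M'" "v \<in> {4, 5, 6} \<union> range (adr k)" for M' v x
    using that unfolding frame_def by auto
  show ?thesis
    unfolding read_table_def
  proof (rule wp_For[where K = R and J = "\<lambda>i M' xs' ys'.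
      frame M' \<and> (\<forall>i'<i. \<forall>j<C. M' (adr k (pair i' j)) = h i' j) \<and>
      M' 4 = b + 2 * (\<Sum>i'<i. \<Sum>j<C. (h i' j)\<^sup>2) \<and>
      xs' = concat (map (\<lambda>i. map (h i) [0..<C]) [i..<R]) @ zs \<and> ys' = ys"], goal_cases)
    case 1
    then show ?case using b xs by (simp add: frame_def)
  next
    case (2 i M' xs' ys')
    then show ?case using rows fr by blast
  next
    case (3 i M' xs' ys' x)
    then show ?case using k by (simp add: fr_upd)
  next
    case (4 i M1 xs1 ys1)
    show ?case
    proof (rule wp_For[where K = C and J = "\<lambda>l M' xs' ys'.
        frame M' \<and> (\<forall>i'<i. \<forall>j<C. M' (adr k (pair i' j)) = h i' j) \<and>
        (\<forall>j<l. M' (adr k (pair i j)) = h i j) \<and>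
        M' 4 = b + 2 * (\<Sum>i'<i. \<Sum>j<C. (h i' j)\<^sup>2) + 2 * (\<Sum>j<l. (h i j)\<^sup>2) \<and> M' 5 = int i \<and>
        xs' = map (h i) [l..<C] @ concat (map (\<lambda>i. map (h i) [0..<C]) [Suc i..<R]) @ zs \<and>
        ys' = ys"], goal_cases)
      case 1
      then show ?case using 4 by (simp add: upt_conv_Cons)
    next
      case (2 l M' xs' ys')
      then show ?case using cols fr by blast
    next
      case (3 l M' xs' ys' x)
      then show ?case using k by (simp add: fr_upd)
    next
      case (4 l M2 xs2 ys2)
      define A where "A = adr k (pair i l)"
      have A: "nat (eval (cell k (pair_expr (reg 5) (reg 6))) M') = A"
        if "M' 5 = int i" "M' 6 = int l" for M'
        unfolding A_def by (intro eval_cell eval_pair) (use that in simp_all)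
      have xs2: "xs2 = h i l # map (h i) [Suc l..<C] @
          concat (map (\<lambda>i. map (h i) [0..<C]) [Suc i..<R]) @ zs"
        using 4 by (simp add: upt_conv_Cons)
      have A_neq: "A \<noteq> v" if "v < 16" for v using that unfolding A_def by simp
      \<comment> \<open>Squares are nonnegative, so the running total never exceeds its final value,
        and only that one has to be known to fit.\<close>
      have bound: "b + 2 * (\<Sum>i'<i. \<Sum>j<C. (h i' j)\<^sup>2) + 2 * (\<Sum>j<Suc l. (h i j)\<^sup>2) \<le> 2 ^ w"
      proof -
        have "(\<Sum>j<Suc l. (h i j)\<^sup>2) \<le> (\<Sum>j<C. (h i j)\<^sup>2)"
          using \<open>l < C\<close> by (intro sum_mono2) auto
        moreover have "(\<Sum>i'<Suc i. \<Sum>j<C. (h i' j)\<^sup>2) \<le> (\<Sum>i'<R. \<Sum>j<C. (h i' j)\<^sup>2)"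
          using \<open>i < R\<close> by (intro sum_mono2) (auto intro!: sum_nonneg)
        ultimately show ?thesis using b by simp
      qed
      have nonneg: "0 \<le> b + 2 * (\<Sum>i'<i. \<Sum>j<C. (h i' j)\<^sup>2) + 2 * (\<Sum>j<Suc l. (h i j)\<^sup>2)"
        using b by (intro add_nonneg_nonneg mult_nonneg_nonneg sum_nonneg) auto
      define v where
        "v = b + 2 * (\<Sum>i'<i. \<Sum>j<C. (h i' j)\<^sup>2) + 2 * (\<Sum>j<Suc l. (h i j)\<^sup>2)"
      have frA: "frame (M2(A := x, 4 := y))" for x y
        using 4 by (intro fr_upd) (auto simp: A_def)
      have e: "eval (Add (reg 4) (Mult (Const 2) (Mult (Reg (cell k (pair_expr (reg 5) (reg 6))))
          (Reg (cell k (pair_expr (reg 5) (reg 6))))))) (M2(A := h i l)) = v"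
        using 4 A[of "M2(A := h i l)"] A_neq by (simp add: v_def power2_eq_square)
      show ?case
        unfolding xs2 seqs_simps
      proof (intro wp_Seq wp_Read wp_Store wp_Skip, goal_cases)
        case 1
        then show ?case using A[of M2] 4 e bound nonneg by (simp add: v_def)
      next
        case 2
        have "nat (eval (cell k (pair_expr (reg 5) (reg 6))) M2) = A" using A[of M2] 4 by simp
        moreover have "(M2(A := h i l, 4 := v)) (adr k (pair i j)) = h i j" if "j < Suc l" for j
          using that 4 k by (cases "j = l") (auto simp: A_def)
        moreover have "(M2(A := h i l, 4 := v)) (adr k (pair i' j)) =
            h i' j" if "i' < i" "j < C" for i' j
          using that 4 k by (auto simp: A_def)
        ultimately show ?case
          using 4 e A_neq frA by (simp add: v_def)
      qed
    next
      case (5 M2 xs2 ys2)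
      then show ?case by (auto simp: less_Suc_eq)
    next
      case 6
      then show ?case using \<open>C \<le> N\<close> by simp
    qed
  next
    case (5 M1 xs1 ys1)
    then show ?case using Q unfolding frame_def by simp
  next
    case 6
    then show ?case using \<open>R \<le> N\<close> by simp
  qed
qed

text \<open>Array 7 is required to be zero because the Ferrers matrix is later created by writing
  ones only.\<close>

definition inputs :: "memory \<Rightarrow> bool" where
  "inputs M \<longleftrightarrow> M 2 = int m \<and> M 3 = int n \<and> M 4 = big \<and>
     (\<forall>i<m. \<forall>k\<le>n. M (adr 2 (pair i k)) = f i k) \<and> (\<forall>j<n. \<forall>k\<le>m. M (adr 3 (pair j k)) = g j k) \<and>
     (\<forall>x. M (adr 7 x) = 0)"

lemma inputs_upd [simp]:
  "v < 16 \<Longrightarrow> v \<noteq> 2 \<Longrightarrow> v \<noteq> 3 \<Longrightarrow> v \<noteq> 4 \<Longrightarrow> inputs (M(v := x)) = inputs M"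
  "4 \<le> k \<Longrightarrow> k < 7 \<Longrightarrow> inputs (M(adr k y := x)) = inputs M"
  unfolding inputs_def by auto

lemma wp_read_input:
  assumes M: "\<And>x. M x = 0" and Q: "\<And>M'. inputs M' \<Longrightarrow> Q M' [] ys"
  shows "wp read_input Q M (encode_instance m n f g) ys"
proof -
  define sf where "sf = (\<Sum>i<m. \<Sum>j<n + 1. (f i j)\<^sup>2)"
  define sg where "sg = (\<Sum>i<n. \<Sum>j<m + 1. (g i j)\<^sup>2)"
  have big: "big = 1 + 2 * sf + 2 * sg"
    unfolding big_def total_def fsq_def gsq_def sf_def sg_def by simp
  have nonneg: "0 \<le> sf" "0 \<le> sg"
    unfolding sf_def sg_def by (intro sum_nonneg; simp)+
  define M0 where "M0 = M(2 := int m, 3 := int n, 4 := 1)"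
  have second: "wp (read_table 3 (reg 3) (Add (reg 2) (Const 1))) (wp Skip Q) M1
      (concat (map (\<lambda>i. map (g i) [0..<m + 1]) [0..<n]) @ []) ys"
    if F: "\<forall>i<m. \<forall>j<n + 1. M1 (adr 2 (pair i j)) = f i j" and "M1 4 = 1 + 2 * sf"
      and fr: "\<forall>x. x \<notin> {4, 5, 6} \<union> range (adr 2) \<longrightarrow> M1 x = M0 x" for M1
  proof (rule wp_read_table[where R = n and C = "m + 1" and h = g and b = "1 + 2 * sf"])
    show "eval (reg 3) M' = int n" if "M' 3 = M1 3" for M'
      using that fr by (simp add: M0_def)
    show "eval (Add (reg 2) (Const 1)) M' = int (m + 1)" if "M' 2 = M1 2" for M'
      using that fr by (simp add: M0_def)
    show "1 + 2 * sf + 2 * (\<Sum>i<n. \<Sum>j<m + 1. (g i j)\<^sup>2) \<le> 2 ^ w"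
      using big_le unfolding big sg_def .
  next
    fix M2
    assume G: "\<forall>i<n. \<forall>j<m + 1. M2 (adr 3 (pair i j)) = g i j"
      and b: "M2 4 = 1 + 2 * sf + 2 * (\<Sum>i<n. \<Sum>j<m + 1. (g i j)\<^sup>2)"
      and fr2: "\<forall>x. x \<notin> {4, 5, 6} \<union> range (adr 3) \<longrightarrow> M2 x = M1 x"
    have "inputs M2"
      unfolding inputs_def
    proof (intro conjI allI impI)
      show "M2 2 = int m" "M2 3 = int n" using fr fr2 by (simp_all add: M0_def)
      show "M2 4 = big" unfolding b big sg_def ..
      show "M2 (adr 2 (pair i k)) = f i k" if "i < m" "k \<le> n" for i k
        using fr2 F that by simp
      show "M2 (adr 3 (pair j k)) = g j k" if "j < n" "k \<le> m" for j k
        using G that by simp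
      show "M2 (adr 7 x) = 0" for x
        using fr fr2 M by (simp add: M0_def)
    qed
    then show "wp Skip Q M2 [] ys" by (intro wp_Skip Q)
  qed (use that mn_le nonneg in simp_all)
  have first: "wp (read_table 2 (reg 2) (Add (reg 3) (Const 1)))
      (wp (read_table 3 (reg 3) (Add (reg 2) (Const 1))) (wp Skip Q)) M0
      (concat (map (\<lambda>i. map (f i) [0..<n + 1]) [0..<m]) @
       concat (map (\<lambda>i. map (g i) [0..<m + 1]) [0..<n]) @ []) ys"
  proof (rule wp_read_table[where R = m and C = "n + 1" and h = f and b = 1])
    show "eval (reg 2) M' = int m" if "M' 2 = M0 2" for M'
      using that by (simp add: M0_def)
    show "eval (Add (reg 3) (Const 1)) M' = int (n + 1)" if "M' 3 = M0 3" for M'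
      using that by (simp add: M0_def)
    show "1 + 2 * (\<Sum>i<m. \<Sum>j<n + 1. (f i j)\<^sup>2) \<le> 2 ^ w"
      using big_le nonneg unfolding big sf_def by linarith
  next
    fix M1
    assume "\<forall>i<m. \<forall>j<n + 1. M1 (adr 2 (pair i j)) = f i j"
      "M1 4 = 1 + 2 * (\<Sum>i<m. \<Sum>j<n + 1. (f i j)\<^sup>2)"
      "\<forall>x. x \<notin> {4, 5, 6} \<union> range (adr 2) \<longrightarrow> M1 x = M0 x"
    then show "wp (read_table 3 (reg 3) (Add (reg 2) (Const 1))) (wp Skip Q) M1
        (concat (map (\<lambda>i. map (g i) [0..<m + 1]) [0..<n]) @ []) ys"
      by (intro second) (auto simp: sf_def)
  qed (use mn_le in \<open>simp_all add: M0_def\<close>)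
  have both: "wp (Seq (read_table 2 (reg 2) (Add (reg 3) (Const 1)))
      (Seq (read_table 3 (reg 3) (Add (reg 2) (Const 1))) Skip)) Q M0
      (concat (map (\<lambda>i. map (f i) [0..<n + 1]) [0..<m]) @
       concat (map (\<lambda>i. map (g i) [0..<m + 1]) [0..<n]) @ []) ys"
    by (rule wp_Seq, rule wp_mono[OF first]) (rule wp_Seq)
  show ?thesis
    unfolding read_input_def seqs_simps encode_instance_def append_Cons append_Nil
    by (rule wp_Seq, rule wp_Read, rule wp_Seq, rule wp_Read, rule wp_Seq, rule wp_Store)
      (use four_le both in \<open>simp_all add: M0_def\<close>)
qed

section \<open>Filling the tables\<close>

lemma wp_try_move:
  assumes "M 9 = fst p" "M 10 = int (snd p)" "eval e M = x"
    and "\<bar>fst (improve x h p)\<bar> \<le> 2 ^ w" "h \<le> 3"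
    and "Q (M(9 := fst (improve x h p), 10 := int (snd (improve x h p)))) xs ys"
  shows "wp (try_move h e) Q M xs ys"
  unfolding try_move_def seqs_simps
proof (rule wp_Cond)
  assume "0 < eval (Sub (reg 9) e) M"
  then have imp: "improve x h p = (x, h)" using assms by (simp add: improve_def)
  have "int h \<le> 2 ^ w" using four_le \<open>h \<le> 3\<close> by linarith
  then show "wp (Seq (assign 9 e) (Seq (assign 10 (Const (int h))) Skip)) Q M xs ys"
    using assms imp by (intro wp_Seq wp_Store wp_Skip) simp_all
next
  assume "eval (Sub (reg 9) e) M \<le> 0"
  then have "improve x h p = p" using assms by (simp add: improve_def)
  then have "M(9 := fst (improve x h p), 10 := int (snd (improve x h p))) = M"
    using assms by (simp add: fun_eq_iff)
  then show "wp Skip Q M xs ys" using assms(6) by (simp add: wp_Skip)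
qed

definition states :: "(nat \<times> nat \<times> nat \<times> nat) set" where
  "states = {(a, r, c, d). a \<le> m \<and> r \<le> n \<and> c \<le> n \<and> d \<le> (m - a) * n}"

text \<open>The part of the table that is finished when the four nested loops arrive at this
  quadruple.\<close>

definition before :: "nat \<Rightarrow> nat \<Rightarrow> nat \<Rightarrow> nat \<Rightarrow> (nat \<times> nat \<times> nat \<times> nat) set" where
  "before a r c d = {(a', r', c', d') \<in> states. a' < a \<or> a' = a \<and>
     (r' < r \<or> r' = r \<and> (c' < c \<or> c' = c \<and> d' < d))}"

definition opt_table :: "(nat \<times> nat \<times> nat \<times> nat) set \<Rightarrow> memory \<Rightarrow> bool" where
  "opt_table D M \<longleftrightarrow> (\<forall>a r c d. (a, r, c, d) \<in> D \<longrightarrow> M (adr 4 (node a r c d)) = fst (opt a r c d) \<and>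
     M (adr 5 (node a r c d)) = int (snd (opt a r c d)))"

lemma opt_table_upd [simp]:
  "v < 16 \<Longrightarrow> opt_table D (M(v := x)) = opt_table D M"
  "k < 16 \<Longrightarrow> k \<noteq> 4 \<Longrightarrow> k \<noteq> 5 \<Longrightarrow> opt_table D (M(adr k y := x)) = opt_table D M"
  unfolding opt_table_def by auto

lemma opt_table_mono: "opt_table D M \<Longrightarrow> D' \<subseteq> D \<Longrightarrow> opt_table D' M"
  unfolding opt_table_def by blast

text \<open>A commit adds at most \<open>c\<close> to the excess, hence at most \<open>n\<close>,
  while the bound on \<open>d\<close> grows by \<open>n\<close>.\<close>

lemma commit_d_le:
  assumes "(a, r, c, d) \<in> states" "0 < a"
  shows "(a - 1, r, c, d + c - r) \<in> states"
proof -
  have "m - (a - 1) = Suc (m - a)" using assms unfolding states_def by auto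
  then show ?thesis using assms unfolding states_def by auto
qed

lemma wp_fill_node:
  assumes inp: "inputs M" and tab: "opt_table (before a r c d) M" and st: "(a, r, c, d) \<in> states"
    and reg: "M 5 = int a" "M 6 = int r" "M 7 = int c" "M 8 = int d"
    and Q: "\<And>x y. Q (M(9 := x, 10 := y, adr 4 (node a r c d) := fst (opt a r c d),
      adr 5 (node a r c d) := int (snd (opt a r c d)))) xs ys"
  shows "wp fill_node Q M xs ys"
proof -
  have le: "a \<le> m" "r \<le> n" "c \<le> n" "d \<le> (m - a) * n" using st unfolding states_def by auto
  define p0 where "p0 = (if a = 0 \<and> r = 0 \<and> c = 0 \<and> d = 0 then 0 else big, 0 :: nat)"
  define p1 where "p1 = (if 0 < r then improve (fst (opt a (r - 1) c d)) 1 p0 else p0)"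
  define p2 where
    "p2 = (if 0 < c then improve (g (c - 1) (m - a) + fst (opt a r (c - 1) d)) 2 p1 else p1)"
  define p3 where "p3 = (if 0 < a \<and> r \<le> d + c
      then improve (f (m - a) r + fst (opt (a - 1) r c (d + c - r))) 3 p2 else p2)"
  have opt: "opt a r c d = p3"
    unfolding p3_def p2_def p1_def p0_def by (subst opt.simps) (simp only: Let_def)
  \<comment> \<open>\<open>improve\<close> can only lower the value, so all intermediate values lie
    between the final one and \<open>big\<close> and fit into a register.\<close>
  have desc: "fst p3 \<le> fst p2" "fst p2 \<le> fst p1" "fst p1 \<le> fst p0" "fst p0 \<le> big"
    using big_nonneg
    by (simp add: p3_def fst_improve, simp add: p2_def fst_improve, simp add: p1_def fst_improve,
        simp add: p0_def)
  have "- total \<le> fst p3" unfolding opt[symmetric] using le by (intro opt_ge_total)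
  then have "- big \<le> fst p3" using total_nonneg unfolding big_def by linarith
  then have abs: "\<bar>fst p3\<bar> \<le> 2 ^ w" "\<bar>fst p2\<bar> \<le> 2 ^ w" "\<bar>fst p1\<bar> \<le> 2 ^ w" "\<bar>fst p0\<bar> \<le> 2 ^ w"
    using desc big_le by linarith+
  have snd_le: "snd p3 \<le> 3"
    unfolding p3_def p2_def p1_def p0_def improve_def by simp
  define mem where "mem p = M(9 := fst p, 10 := int (snd p))" for p
  have mem: "mem p 9 = fst p" "mem p 10 = int (snd p)" "mem p 2 = int m" "mem p 3 = int n"
    "mem p 4 = big" "mem p 5 = int a" "mem p 6 = int r" "mem p 7 = int c" "mem p 8 = int d"
    "mem p (adr k y) = M (adr k y)" "(mem p)(9 := x, 10 := int y) = mem (x, y)" for p k y x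
    unfolding mem_def using reg inp by (auto simp: inputs_def)
  have tab': "M (adr 4 (node a' r' c' d')) = fst (opt a' r' c' d')"
    if "(a', r', c', d') \<in> before a r c d" for a' r' c' d'
    using tab that unfolding opt_table_def by blast
  \<comment> \<open>The stages are treated from the last to the first, the earlier ones for an
    arbitrary postcondition, and composed at the end.\<close>
  have last: "wp (Seq (Store (cell 4 (node_expr (reg 5) (reg 6) (reg 7) (reg 8))) (reg 9))
      (Seq (Store (cell 5 (node_expr (reg 5) (reg 6) (reg 7) (reg 8))) (reg 10)) Skip)) Q (mem p3)
          xs ys"
  proof -
    have A: "nat (eval (cell 4 (node_expr (reg 5) (reg 6) (reg 7) (reg 8))) (mem p3)) =
        adr 4 (node a r c d)"
      by (intro eval_cell eval_pair) (simp_all add: mem)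
    have B: "nat (eval (cell 5 (node_expr (reg 5) (reg 6) (reg 7) (reg 8)))
        ((mem p3)(adr 4 (node a r c d) := fst p3))) = adr 5 (node a r c d)"
      by (intro eval_cell eval_pair) (simp_all add: mem)
    have "int (snd p3) \<le> 2 ^ w" using snd_le four_le by linarith
    moreover have "Q ((mem p3)(adr 4 (node a r c d) := fst p3, adr 5 (node a r c d) :=
        int (snd p3))) xs ys"
      using Q[of "fst p3" "int (snd p3)"] by (simp add: mem_def opt)
    ultimately show ?thesis
      using abs A B by (intro wp_Seq wp_Store wp_Skip) (simp_all add: mem)
  qed
  have commit: "wp (Cond (reg 5) (Cond (Sub (Add (Const 1) (Add (reg 8) (reg 7))) (reg 6))
      (try_move 3
       (Add (Reg (cell 2 (pair_expr (Sub (reg 2) (reg 5)) (reg 6))))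
         (Reg (cell 4 (node_expr (Sub (reg 5) (Const 1)) (reg 6) (reg 7)
           (Sub (Add (reg 8) (reg 7)) (reg 6))))))) Skip) Skip) Q' (mem p2) xs ys"
    if Q': "Q' (mem p3) xs ys" for Q'
  proof (cases "0 < a \<and> r \<le> d + c")
    case True
    have A: "nat (eval (cell 2 (pair_expr (Sub (reg 2) (reg 5)) (reg 6))) (mem p2)) =
        adr 2 (pair (m - a) r)"
      by (intro eval_cell eval_pair) (use le in \<open>simp_all add: mem of_nat_diff\<close>)
    have B: "nat (eval (cell 4 (node_expr (Sub (reg 5) (Const 1)) (reg 6) (reg 7)
          (Sub (Add (reg 8) (reg 7)) (reg 6)))) (mem p2)) = adr 4 (node (a - 1) r c (d + c - r))"
      by (intro eval_cell eval_pair) (use True in \<open>simp_all add: mem of_nat_diff\<close>)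
    have p3: "p3 = improve (f (m - a) r + fst (opt (a - 1) r c (d + c - r))) 3 p2"
      unfolding p3_def using True by simp
    have "(a - 1, r, c, d + c - r) \<in> before a r c d"
      using commit_d_le[OF st] True unfolding before_def by auto
    moreover have "M (adr 2 (pair (m - a) r)) = f (m - a) r"
      using inp le True unfolding inputs_def by simp
    ultimately have e: "eval (Add (Reg (cell 2 (pair_expr (Sub (reg 2) (reg 5)) (reg 6))))
         (Reg (cell 4 (node_expr (Sub (reg 5) (Const 1)) (reg 6) (reg 7)
           (Sub (Add (reg 8) (reg 7)) (reg 6)))))) (mem p2) =
         f (m - a) r + fst (opt (a - 1) r c (d + c - r))"
      using tab' by (simp only: eval.simps A B mem)
    have "wp (try_move 3 (Add (Reg (cell 2 (pair_expr (Sub (reg 2) (reg 5)) (reg 6))))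
         (Reg (cell 4 (node_expr (Sub (reg 5) (Const 1)) (reg 6) (reg 7)
           (Sub (Add (reg 8) (reg 7)) (reg 6))))))) Q' (mem p2) xs ys"
      by (rule wp_try_move[OF _ _ e]) (use Q' abs p3 in \<open>simp_all add: mem\<close>)
    then show ?thesis using True by (intro wp_Cond) (simp_all add: mem)
  next
    case False
    have "p3 = p2" unfolding p3_def using False by (rule if_not_P)
    then have "wp Skip Q' (mem p2) xs ys" using Q' by (simp add: wp_Skip)
    then show ?thesis using False by (intro wp_Cond) (auto simp: mem)
  qed
  have dec_c: "wp (Cond (reg 7) (try_move 2
       (Add (Reg (cell 3 (pair_expr (Sub (reg 7) (Const 1)) (Sub (reg 2) (reg 5)))))
         (Reg (cell 4 (node_expr (reg 5) (reg 6) (Sub (reg 7) (Const 1)) (reg 8)))))) Skip)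
       Q' (mem p1) xs ys"
    if Q': "Q' (mem p2) xs ys" for Q'
  proof (cases "0 < c")
    case True
    have A: "nat (eval (cell 3 (pair_expr (Sub (reg 7) (Const 1)) (Sub (reg 2) (reg 5)))) (mem
        p1)) =
        adr 3 (pair (c - 1) (m - a))"
      by (intro eval_cell eval_pair) (use le True in \<open>simp_all add: mem of_nat_diff\<close>)
    have B: "nat (eval (cell 4 (node_expr (reg 5) (reg 6) (Sub (reg 7) (Const 1)) (reg 8))) (mem
        p1)) =
        adr 4 (node a r (c - 1) d)"
      by (intro eval_cell eval_pair) (use True in \<open>simp_all add: mem of_nat_diff\<close>)
    have p2: "p2 = improve (g (c - 1) (m - a) + fst (opt a r (c - 1) d)) 2 p1"
      unfolding p2_def using True by simp
    have "(a, r, c - 1, d) \<in> before a r c d"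
      using st True unfolding before_def states_def by auto
    moreover have "M (adr 3 (pair (c - 1) (m - a))) = g (c - 1) (m - a)"
      using inp le True unfolding inputs_def by simp
    ultimately have e: "eval (Add (Reg (cell 3 (pair_expr (Sub (reg 7) (Const 1)) (Sub (reg 2)
        (reg 5)))))
         (Reg (cell 4 (node_expr (reg 5) (reg 6) (Sub (reg 7) (Const 1)) (reg 8))))) (mem p1) =
         g (c - 1) (m - a) + fst (opt a r (c - 1) d)"
      using tab' by (simp only: eval.simps A B mem)
    have "wp (try_move 2 (Add (Reg (cell 3 (pair_expr (Sub (reg 7) (Const 1)) (Sub (reg 2) (reg
        5)))))
         (Reg (cell 4 (node_expr (reg 5) (reg 6) (Sub (reg 7) (Const 1)) (reg 8)))))) Q' (mem p1)
             xs ys"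
      by (rule wp_try_move[OF _ _ e]) (use Q' abs p2 in \<open>simp_all add: mem\<close>)
    then show ?thesis using True by (intro wp_Cond) (simp_all add: mem)
  next
    case False
    then have "p2 = p1" unfolding p2_def by simp
    then have "wp Skip Q' (mem p1) xs ys" using Q' by (simp add: wp_Skip)
    then show ?thesis using False by (intro wp_Cond) (auto simp: mem)
  qed
  have dec_r: "wp (Cond (reg 6) (try_move 1
       (Reg (cell 4 (node_expr (reg 5) (Sub (reg 6) (Const 1)) (reg 7) (reg 8))))) Skip)
       Q' (mem p0) xs ys"
    if Q': "Q' (mem p1) xs ys" for Q'
  proof (cases "0 < r")
    case True
    have B: "nat (eval (cell 4 (node_expr (reg 5) (Sub (reg 6) (Const 1)) (reg 7) (reg 8))) (mem
        p0)) =
        adr 4 (node a (r - 1) c d)"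
      by (intro eval_cell eval_pair) (use True in \<open>simp_all add: mem of_nat_diff\<close>)
    have p1: "p1 = improve (fst (opt a (r - 1) c d)) 1 p0"
      unfolding p1_def using True by simp
    have "(a, r - 1, c, d) \<in> before a r c d"
      using st True unfolding before_def states_def by auto
    then have e: "eval (Reg (cell 4 (node_expr (reg 5) (Sub (reg 6) (Const 1)) (reg 7) (reg 8))))
        (mem p0) =
         fst (opt a (r - 1) c d)"
      using tab' by (simp only: eval.simps B mem)
    have "wp (try_move 1 (Reg (cell 4 (node_expr (reg 5) (Sub (reg 6) (Const 1)) (reg 7) (reg 8)))))
        Q' (mem p0) xs ys"
      by (rule wp_try_move[OF _ _ e]) (use Q' abs p1 in \<open>simp_all add: mem\<close>)
    then show ?thesis using True by (intro wp_Cond) (simp_all add: mem)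
  next
    case False
    then have "p1 = p0" unfolding p1_def by simp
    then have "wp Skip Q' (mem p0) xs ys" using Q' by (simp add: wp_Skip)
    then show ?thesis using False by (intro wp_Cond) (auto simp: mem)
  qed
  have start: "wp (Cond (Sub (Const 1) (Add (Add (reg 5) (reg 6)) (Add (reg 7) (reg 8))))
      (assign 9 (Const 0)) Skip) Q' (mem (big, 0)) xs ys"
    if Q': "Q' (mem p0) xs ys" for Q'
  proof (rule wp_Cond)
    assume "0 < eval (Sub (Const 1) (Add (Add (reg 5) (reg 6)) (Add (reg 7) (reg 8)))) (mem (big,
        0))"
    then have "p0 = (0, 0)" unfolding p0_def by (auto simp: mem)
    then show "wp (assign 9 (Const 0)) Q' (mem (big, 0)) xs ys"
      using Q' by (intro wp_Store) (simp_all add: mem_def fun_upd_twist)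
  next
    assume "eval (Sub (Const 1) (Add (Add (reg 5) (reg 6)) (Add (reg 7) (reg 8)))) (mem (big,
        0)) \<le> 0"
    then have "p0 = (big, 0)" unfolding p0_def by (auto simp: mem)
    then show "wp Skip Q' (mem (big, 0)) xs ys" using Q' by (simp add: wp_Skip)
  qed
  have init1: "wp (assign 9 (reg 4)) Q' M xs ys" if "Q' (M(9 := big)) xs ys" for Q'
    using that inp big_le big_nonneg by (intro wp_Store) (simp_all add: inputs_def)
  have init2: "wp (assign 10 (Const 0)) Q' (M(9 := big)) xs ys" if "Q' (mem (big, 0)) xs ys" for Q'
    using that by (intro wp_Store) (simp_all add: mem_def)
  show ?thesis
    unfolding fill_node_def seqs_simps
    by (rule wp_Seq, rule init1, rule wp_Seq, rule init2, rule wp_Seq, rule start,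
        rule wp_Seq, rule dec_r, rule wp_Seq, rule dec_c, rule wp_Seq, rule commit, rule last)
qed

text \<open>An exhausted inner loop amounts to one step of the next outer loop. The last fact is an
  inclusion, as the quadruple is added only if it is a state.\<close>

lemma before_Suc:
  "before (Suc m) 0 0 0 = states"
  "before a (Suc n) 0 0 = before (Suc a) 0 0 0"
  "before a r (Suc n) 0 = before a (Suc r) 0 0"
  "before a r c (Suc ((m - a) * n)) = before a r (Suc c) 0"
  "before a r c (Suc d) \<subseteq> insert (a, r, c, d) (before a r c d)"
  unfolding before_def states_def by (auto simp: less_Suc_eq)

lemma wp_fill_tables:
  assumes inp: "inputs M" and Q: "\<And>M'. inputs M' \<Longrightarrow> opt_table states M' \<Longrightarrow> Q M' xs ys"
  shows "wp fill_tables Q M xs ys"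
  unfolding fill_tables_def
proof (rule wp_For[where K = "Suc m" and J = "\<lambda>a M' xs' ys'. inputs M' \<and>
    opt_table (before a 0 0 0) M' \<and>
    xs' = xs \<and> ys' = ys"], goal_cases)
  case 1
  then show ?case using inp by (simp add: opt_table_def before_def)
next
  case (2 a M1 xs1 ys1)
  then show ?case by (simp add: inputs_def)
next
  case (4 a M1 xs1 ys1)
  note a = this
  show ?case
  proof (rule wp_For[where K = "Suc n" and J = "\<lambda>r M' xs' ys'. inputs M' \<and>
      opt_table (before a r 0 0) M' \<and> M' 5 = int a \<and> xs' = xs \<and> ys' = ys"], goal_cases)
    case (2 r M2 xs2 ys2)
    then show ?case by (simp add: inputs_def)
  next
    case (4 r M2 xs2 ys2)
    note r = this
    show ?case
    proof (rule wp_For[where K = "Suc n" and J = "\<lambda>c M' xs' ys'. inputs M' \<and>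
        opt_table (before a r c 0) M' \<and> M' 5 = int a \<and> M' 6 = int r \<and> xs' = xs \<and> ys' = ys"],
        goal_cases)
      case (2 c M3 xs3 ys3)
      then show ?case by (simp add: inputs_def)
    next
      case (4 c M3 xs3 ys3)
      note c = this
      show ?case
      proof (rule wp_For[where K = "Suc ((m - a) * n)" and J = "\<lambda>d M' xs' ys'. inputs M' \<and>
          opt_table (before a r c d) M' \<and> M' 5 = int a \<and> M' 6 = int r \<and> M' 7 = int c \<and>
          xs' = xs \<and> ys' = ys"], goal_cases)
        case (2 d M4 xs4 ys4)
        then show ?case using a by (simp add: inputs_def of_nat_diff)
      next
        case (4 d M4 xs4 ys4)
        have st: "(a, r, c, d) \<in> states" using 4 a r c by (auto simp: states_def)
        have "opt_table (before a r c (Suc d)) (M4(9 := x, 10 := y,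
            adr 4 (node a r c d) := fst (opt a r c d), adr 5 (node a r c d) :=
                int (snd (opt a r c d))))"
          for x y
        proof (rule opt_table_mono[OF _ before_Suc(5)])
          show "opt_table (insert (a, r, c, d) (before a r c d)) (M4(9 := x, 10 := y,
            adr 4 (node a r c d) := fst (opt a r c d), adr 5 (node a r c d) :=
                int (snd (opt a r c d))))"
            using 4 unfolding opt_table_def by auto
        qed
        then show ?case
          using 4 by (intro wp_fill_node[of M4 a r c d] st) simp_all
      next
        case 6
        have "(m - a) * n \<le> m * n" by simp
        then show ?case using mn_le(5) by linarith
      qed (use c in \<open>simp_all add: before_Suc\<close>)
    qed (use r mn_le in \<open>simp_all add: before_Suc\<close>)
  qed (use a mn_le in \<open>simp_all add: before_Suc\<close>)
qed (use Q mn_le in \<open>simp_all add: before_Suc\<close>)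

section \<open>Building the Ferrers matrix along the moves\<close>

definition ferrers :: "nat \<Rightarrow> (nat \<Rightarrow> nat) \<Rightarrow> (nat \<Rightarrow> nat) \<Rightarrow> memory \<Rightarrow> bool" where
  "ferrers i \<rho> \<kappa> M \<longleftrightarrow> (\<forall>k j. M (adr 7 (pair k j)) = of_bool (k < i \<and> j < \<kappa> k)) \<and>
     (\<forall>k<i. M (adr 6 k) = int (\<kappa> k) - int (\<rho> k))"

lemma ferrers_upd [simp]:
  "v < 16 \<Longrightarrow> ferrers i \<rho> \<kappa> (M(v := x)) = ferrers i \<rho> \<kappa> M"
  unfolding ferrers_def by auto

text \<open>Row \<open>m - a\<close> receives \<open>c\<close> ones, its other cells being zero by
  \<open>ferrers\<close>. The stored difference \<open>c - r\<close> is the excess of that row, from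
  which the repair starts.\<close>

lemma wp_follow_commit:
  assumes par: "M 2 = int m" and reg: "M 5 = int a" "M 6 = int r" "M 7 = int c" "M 8 = int d"
    and le: "0 < a" "a \<le> m" "r \<le> n" "c \<le> n" "r \<le> d + c" "d + c - r \<le> N"
    and fer: "ferrers (m - a) \<rho> \<kappa> M"
    and Q: "\<And>M'. ferrers (Suc (m - a)) (\<rho>(m - a := r)) (\<kappa>(m - a := c)) M' \<Longrightarrow> M' 5 = int (a - 1) \<Longrightarrow>
      M' 6 = int r \<Longrightarrow> M' 7 = int c \<Longrightarrow> M' 8 = int (d + c - r) \<Longrightarrow>
      (\<forall>x. x \<notin> {5, 8, 9} \<union> range (adr 6) \<union> range (adr 7) \<longrightarrow> M' x = M x) \<Longrightarrow> Q M' xs ys"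
  shows "wp follow_commit Q M xs ys"
proof -
  define i where "i = m - a"
  define frame where "frame M' \<longleftrightarrow> (\<forall>x. x \<notin> {5, 8, 9} \<union> range (adr 6) \<union> range (adr 7) \<longrightarrow> M' x =
      M x)" for M'
  have fr_upd: "frame (M'(v := x))" if "frame M'" "v \<in> {5, 8,
      9} \<union> range (adr 6) \<union> range (adr 7)" for M' v x
    using that unfolding frame_def by auto
  have fr: "M' 2 = int m" "M' 6 = int r" "M' 7 = int c" if "frame M'" for M'
    using that par reg unfolding frame_def by simp_all
  have loop: "wp (For 9 (reg 7) (Store (cell 7 (pair_expr (Sub (reg 2) (reg 5)) (reg 9))) (Const
      1)))
      Q' M xs ys"
    if Q': "\<And>M'. frame M' \<Longrightarrow> M' 5 = int a \<Longrightarrow> M' 8 = int d \<Longrightarrow>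
        (\<forall>k j. M' (adr 7 (pair k j)) = of_bool (k < Suc i \<and> j < (\<kappa>(i := c)) k)) \<Longrightarrow>
        (\<forall>k<i. M' (adr 6 k) = int (\<kappa> k) - int (\<rho> k)) \<Longrightarrow> Q' M' xs ys" for Q'
  proof (rule wp_For[where K = c and J = "\<lambda>l M' xs' ys'. frame M' \<and> M' 5 = int a \<and> M' 8 = int d \<and>
      (\<forall>k j. M' (adr 7 (pair k j)) = of_bool (k < i \<and> j < \<kappa> k \<or> k = i \<and> j < l)) \<and>
      (\<forall>k<i. M' (adr 6 k) = int (\<kappa> k) - int (\<rho> k)) \<and> xs' = xs \<and> ys' = ys"], goal_cases)
    case 1
    then show ?case using reg fer by (simp add: frame_def ferrers_def i_def)
  next
    case (2 l M1 xs1 ys1)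
    then show ?case using fr by simp
  next
    case (3 l M1 xs1 ys1 x)
    then show ?case by (simp add: fr_upd)
  next
    case (4 l M1 xs1 ys1)
    have A: "nat (eval (cell 7 (pair_expr (Sub (reg 2) (reg 5)) (reg 9))) M1) = adr 7 (pair i l)"
      by (intro eval_cell eval_pair) (use 4 fr le in \<open>simp_all add: of_nat_diff i_def\<close>)
    have "frame (M1(adr 7 (pair i l) := 1))" using 4 by (intro fr_upd) auto
    moreover have "(M1(adr 7 (pair i l) := 1)) (adr 7 (pair k j)) =
        of_bool (k < i \<and> j < \<kappa> k \<or> k = i \<and> j < Suc l)" for k j
      using 4 by (cases "k = i \<and> j = l") auto
    ultimately show ?case
      using 4 A four_le by (intro wp_Store) simp_all
  next
    case (5 M1 xs1 ys1)
    have "of_bool (k < Suc i \<and> j < (\<kappa>(i := c)) k) = (of_bool (k < i \<and> j < \<kappa> k \<or> k = i \<and>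
        j < c) :: int)"
      for k j by (auto simp: less_Suc_eq)
    then show ?case using 5 Q' by metis
  next
    case 6
    then show ?case using le mn_le by simp
  qed
  have rest: "wp (Seq (Store (cell 6 (Sub (reg 2) (reg 5))) (Sub (reg 7) (reg 6)))
     (Seq (assign 8 (Sub (Add (reg 8) (reg 7)) (reg 6))) (Seq (assign 5 (Sub (reg 5) (Const 1)))
         Skip)))
     Q M' xs ys"
    if fM: "frame M'" and r5: "M' 5 = int a" and r8: "M' 8 = int d"
      and m7: "\<forall>k j. M' (adr 7 (pair k j)) = of_bool (k < Suc i \<and> j < (\<kappa>(i := c)) k)"
      and m6: "\<forall>k<i. M' (adr 6 k) = int (\<kappa> k) - int (\<rho> k)" for M'
  proof -
    have A: "nat (eval (cell 6 (Sub (reg 2) (reg 5))) M') = adr 6 i"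
      by (intro eval_cell) (use fr[OF fM] r5 le in \<open>simp add: of_nat_diff i_def\<close>)
    define M'' where "M'' = M'(adr 6 i := int c - int r, 8 := int (d + c - r), 5 := int (a - 1))"
    have fM'': "frame M''" unfolding M''_def by (intro fr_upd fM) auto
    have "ferrers (Suc i) (\<rho>(i := r)) (\<kappa>(i := c)) M''"
      using m6 m7 unfolding ferrers_def M''_def by auto
    then have Q'': "Q M'' xs ys"
      unfolding i_def
    proof (rule Q)
      show "M'' 5 = int (a - 1)" "M'' 8 = int (d + c - r)" unfolding M''_def by simp_all
      show "M'' 6 = int r" "M'' 7 = int c" using fr[OF fM''] by simp_all
      show "\<forall>x. x \<notin> {5, 8, 9} \<union> range (adr 6) \<union> range (adr 7) \<longrightarrow> M'' x = M x"
        using fM'' unfolding frame_def .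
    qed
    have "int (a - 1) \<le> 2 ^ w" "int (d + c - r) \<le> 2 ^ w" "int c \<le> 2 ^ w" "int r \<le> 2 ^ w"
      by (rule nat_le_w, use le mn_le in linarith)+
    moreover from this have "\<bar>int c - int r\<bar> \<le> 2 ^ w" by linarith
    ultimately show ?thesis
      using A Q'' fr[OF fM] r5 r8 le unfolding M''_def
      by (intro wp_Seq wp_Store wp_Skip) (simp_all add: of_nat_diff)
  qed
  show ?thesis
    unfolding follow_commit_def seqs_simps
    by (rule wp_Seq, rule loop, rule rest)
qed

lemma wp_follow_moves:
  assumes "m > 0" "n > 0" and inp: "inputs M" and tab: "opt_table states M"
    and Q: "\<And>M' \<rho> \<kappa>. trace_inv 0 0 0 0 \<rho> \<kappa> \<Longrightarrow> fst (opt 0 0 0 0) = 0 \<Longrightarrow> ferrers m \<rho> \<kappa> M' \<Longrightarrow>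
      M' 2 = int m \<Longrightarrow> M' 3 = int n \<Longrightarrow> Q M' xs ys"
  shows "wp follow_moves Q M xs ys"
proof -
  \<comment> \<open>The disjunction records progress: either the path has stopped, or each of the
    \<open>t\<close> rounds has lowered \<open>a + r + c\<close>.\<close>
  define linv where "linv t M' \<longleftrightarrow> (\<exists>a r c d \<rho> \<kappa>. trace_inv a r c d \<rho> \<kappa> \<and> ferrers (m - a) \<rho> \<kappa> M' \<and>
      M' 5 = int a \<and> M' 6 = int r \<and> M' 7 = int c \<and> M' 8 = int d \<and> M' 2 = int m \<and> M' 3 = int n \<and>
      opt_table states M' \<and> (snd (opt a r c d) = 0 \<or> a + r + c + t \<le> m + n + n))" for t M'
  have linvI: "linv t M'" if "trace_inv a r c d \<rho> \<kappa>" "ferrers (m - a) \<rho> \<kappa> M'"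
    "M' 5 = int a" "M' 6 = int r" "M' 7 = int c" "M' 8 = int d" "M' 2 = int m" "M' 3 = int n"
    "opt_table states M'" "snd (opt a r c d) = 0 \<or> a + r + c + t \<le> m + n + n"
    for t M' a r c d \<rho> \<kappa>
    using that unfolding linv_def by blast
  define M0 where "M0 = M(5 := int m, 6 := int n, 7 := int n, 8 := 0)"
  have loop: "wp (For 11 (Add (reg 2) (Add (reg 3) (reg 3))) (seqs
       [assign 10 (Reg (cell 5 (node_expr (reg 5) (reg 6) (reg 7) (reg 8)))),
        Cond (Sub (reg 10) (Const 2)) follow_commit
         (Cond (Sub (reg 10) (Const 1)) (assign 7 (Sub (reg 7) (Const 1)))
           (Cond (reg 10) (assign 6 (Sub (reg 6) (Const 1))) Skip))])) Q M0 xs ys"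
  proof (rule wp_For[where K = "m + n + n" and J = "\<lambda>t M' xs' ys'. linv t M' \<and> xs' = xs \<and> ys' =
      ys"],
      goal_cases)
    case 1
    have "linv 0 M0"
      by (rule linvI[OF trace_inv_init[of "\<lambda>_. 0" "\<lambda>_. 0"]]) (use inp tab in \<open>simp_all add: M0_def
          ferrers_def inputs_def\<close>)
    then show ?case by simp
  next
    case (2 t M1 xs1 ys1)
    then show ?case by (auto simp: linv_def)
  next
    case (3 t M1 xs1 ys1 x)
    then show ?case by (simp add: linv_def)
  next
    case (4 t M1 xs1 ys1)
    then obtain a r c d \<rho> \<kappa> where tr: "trace_inv a r c d \<rho> \<kappa>" and fer: "ferrers (m - a) \<rho> \<kappa> M1"
      and reg: "M1 5 = int a" "M1 6 = int r" "M1 7 = int c" "M1 8 = int d" "M1 2 = int m" "M1 3 =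
          int n"
      and tab: "opt_table states M1" and le: "snd (opt a r c d) = 0 \<or> a + r + c + t \<le> m + n + n"
      unfolding linv_def by blast
    have st: "(a, r, c, d) \<in> states"
      using tr trace_inv_d_le[OF tr] unfolding trace_inv_def states_def by auto
    have A: "nat (eval (cell 5 (node_expr (reg 5) (reg 6) (reg 7) (reg 8))) M1) =
        adr 5 (node a r c d)"
      by (intro eval_cell eval_pair) (simp_all add: reg)
    have opt: "M1 (adr 5 (node a r c d)) = int (snd (opt a r c d))"
      using tab st unfolding opt_table_def by blast
    have bounds: "a \<le> m" "r \<le> n" "c \<le> n" "d \<le> (m - a) * n" using st unfolding states_def by auto
    define h where "h = snd (opt a r c d)"
    define M2 where "M2 = M1(10 := int h)"
    have reg2: "M2 5 = int a" "M2 6 = int r" "M2 7 = int c" "M2 8 = int d" "M2 2 = int m" "M2 3 =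
        int n"
      "M2 10 = int h" "M2 11 = M1 11" "opt_table states M2" "ferrers (m - a) \<rho> \<kappa> M2"
      unfolding M2_def using reg tab fer by simp_all
    let ?Q = "\<lambda>M' xs' ys'. (linv (Suc t) M' \<and> xs' = xs \<and> ys' = ys) \<and> M' 11 = int t"
    have M11: "M2 11 = int t" using 4 reg2 by simp
    have moves: "wp (Cond (Sub (reg 10) (Const 2)) follow_commit
         (Cond (Sub (reg 10) (Const 1)) (assign 7 (Sub (reg 7) (Const 1)))
           (Cond (reg 10) (assign 6 (Sub (reg 6) (Const 1))) Skip))) ?Q M2 xs ys"
    proof (cases rule: opt_choice[of a r c d])
      case stop
      then have "linv (Suc t) M2" by (intro linvI[OF tr]) (use reg2 in auto)
      moreover have "h = 0" using stop unfolding h_def by simp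
      ultimately show ?thesis by (intro wp_Cond wp_Skip) (use M11 reg2 in simp_all)
    next
      case dec_r
      have "trace_inv a (r - 1) c d \<rho> \<kappa>" using trace_inv_dec_r[OF tr dec_r(2,3)] .
      then have "linv (Suc t) (M2(6 := int (r - 1)))"
        by (rule linvI) (use reg2 le dec_r in auto)
      moreover have "h = 1" using dec_r unfolding h_def by simp
      moreover have "int (r - 1) \<le> 2 ^ w" using bounds mn_le by (intro nat_le_w) simp
      ultimately show ?thesis
        using dec_r M11 reg2 by (intro wp_Cond wp_Store) (simp_all add: of_nat_diff)
    next
      case dec_c
      have "trace_inv a r (c - 1) d \<rho> \<kappa>" using trace_inv_dec_c[OF tr dec_c(2,3)] .
      then have "linv (Suc t) (M2(7 := int (c - 1)))"
        by (rule linvI) (use reg2 le dec_c in auto)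
      moreover have "h = 2" using dec_c unfolding h_def by simp
      moreover have "int (c - 1) \<le> 2 ^ w" using bounds mn_le by (intro nat_le_w) simp
      ultimately show ?thesis
        using dec_c M11 reg2 by (intro wp_Cond wp_Store) (simp_all add: of_nat_diff)
    next
      case commit
      note tr' = trace_inv_commit[OF tr commit(2,3,4)]
      have "d + c - r \<le> (m - (a - 1)) * n" using trace_inv_d_le[OF tr'] .
      also have "\<dots> \<le> m * n" by simp
      finally have "d + c - r \<le> N" using mn_le by linarith
      have eq: "m - (a - 1) = Suc (m - a)" using commit bounds by simp
      have "wp follow_commit ?Q M2 xs ys"
      proof (rule wp_follow_commit[OF reg2(5,1,2,3,4) commit(2) bounds(1,2,3) commit(3)
            \<open>d + c - r \<le> N\<close> reg2(10)])
        fix M'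
        assume fer': "ferrers (Suc (m - a)) (\<rho>(m - a := r)) (\<kappa>(m - a := c)) M'"
          and r': "M' 5 = int (a - 1)" "M' 6 = int r" "M' 7 = int c" "M' 8 = int (d + c - r)"
          and fr: "\<forall>x. x \<notin> {5, 8, 9} \<union> range (adr 6) \<union> range (adr 7) \<longrightarrow> M' x = M2 x"
        have "M' 2 = int m" "M' 3 = int n" "M' 11 = int t" using fr reg2 M11 by simp_all
        moreover have "opt_table states M'"
          using reg2(9) fr unfolding opt_table_def by simp
        moreover have "a - 1 + r + c + Suc t \<le> m + n + n"
          using le commit by linarith
        ultimately have "linv (Suc t) M'"
          by (intro linvI[OF tr']) (use fer' r' eq in auto)
        then show "?Q M' xs ys" using \<open>M' 11 = int t\<close> by simp
      qed
      moreover have "h = 3" using commit unfolding h_def by simp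
      ultimately show ?thesis using reg2 by (intro wp_Cond) simp_all
    qed
    have "int h \<le> 2 ^ w"
    proof -
      have "h \<le> 3" unfolding h_def by (cases rule: opt_choice[of a r c d]) auto
      then show ?thesis using four_le by linarith
    qed
    then have load: "wp (assign 10 (Reg (cell 5 (node_expr (reg 5) (reg 6) (reg 7) (reg 8))))) Q'
        M1 xs ys"
      if "Q' M2 xs ys" for Q'
      using that A opt by (intro wp_Store) (simp_all add: M2_def h_def)
    have "wp (seqs [assign 10 (Reg (cell 5 (node_expr (reg 5) (reg 6) (reg 7) (reg 8)))),
        Cond (Sub (reg 10) (Const 2)) follow_commit
         (Cond (Sub (reg 10) (Const 1)) (assign 7 (Sub (reg 7) (Const 1)))
           (Cond (reg 10) (assign 6 (Sub (reg 6) (Const 1))) Skip))]) ?Q M1 xs ys"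
      unfolding seqs_simps
      by (rule wp_Seq, rule load, rule wp_Seq, rule wp_mono[OF moves], rule wp_Skip)
    then show ?case using 4 by simp
  next
    case (5 M1 xs1 ys1)
    then obtain a r c d \<rho> \<kappa> where tr: "trace_inv a r c d \<rho> \<kappa>" and fer: "ferrers (m - a) \<rho> \<kappa> M1"
      and reg: "M1 2 = int m" "M1 3 = int n"
      and le: "snd (opt a r c d) = 0 \<or> a + r + c + (m + n + n) \<le> m + n + n"
      unfolding linv_def by blast
    \<comment> \<open>After all rounds the second alternative forces \<open>a\<close>,
      \<open>r\<close> and \<open>c\<close> to be zero, where every move other than stopping is
      excluded.\<close>
    have "snd (opt a r c d) = 0"
      using le by (cases rule: opt_choice[of a r c d]) auto
    then have "a = 0" "r = 0" "c = 0" "d = 0" "fst (opt a r c d) = 0"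
      using trace_inv_stop[OF tr] by auto
    then show ?case using Q[of \<rho> \<kappa> M1] tr fer reg 5 by simp
  next
    case 6
    then show ?case using sum_le_N assms(1,2) by simp
  qed
  have "int m \<le> 2 ^ w" "int n \<le> 2 ^ w" by (rule nat_le_w, use mn_le in linarith)+
  moreover have M: "M 2 = int m" "M 3 = int n" using inp unfolding inputs_def by auto
  ultimately have set5: "wp (assign 5 (reg 2)) Q' M xs ys" if "Q' (M(5 := int m)) xs ys" for Q'
    using that by (intro wp_Store) simp_all
  have set6: "wp (assign 6 (reg 3)) Q' (M(5 := int m)) xs ys"
    if "Q' (M(5 := int m, 6 := int n)) xs ys" for Q'
    using that M \<open>int n \<le> 2 ^ w\<close> by (intro wp_Store) simp_all
  have set7: "wp (assign 7 (reg 3)) Q' (M(5 := int m, 6 := int n)) xs ys"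
    if "Q' (M(5 := int m, 6 := int n, 7 := int n)) xs ys" for Q'
    using that M \<open>int n \<le> 2 ^ w\<close> by (intro wp_Store) simp_all
  have set8: "wp (assign 8 (Const 0)) Q' (M(5 := int m, 6 := int n, 7 := int n)) xs ys"
    if "Q' M0 xs ys" for Q'
    using that by (intro wp_Store) (simp_all add: M0_def)
  show ?thesis
    unfolding follow_moves_def seqs_simps
    by (rule wp_Seq, rule set5, rule wp_Seq, rule set6, rule wp_Seq, rule set7, rule wp_Seq,
        rule set8,
        rule wp_Seq, rule wp_mono[OF loop[unfolded seqs_simps]], rule wp_Skip)
qed

section \<open>Repairing the matrix in memory\<close>

definition holds :: "(nat \<Rightarrow> nat) \<Rightarrow> (nat \<Rightarrow> nat \<Rightarrow> nat) \<Rightarrow> memory \<Rightarrow> bool" where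
  "holds \<rho> A M \<longleftrightarrow> M 2 = int m \<and> M 3 = int n \<and> (\<forall>k<m. \<forall>j<n. M (adr 7 (pair k j)) = int (A k j)) \<and>
     (\<forall>k<m. M (adr 6 k) = excess \<rho> A k)"

lemma holds_upd [simp]:
  "v < 16 \<Longrightarrow> v \<noteq> 2 \<Longrightarrow> v \<noteq> 3 \<Longrightarrow> holds \<rho> A (M(v := x)) = holds \<rho> A M"
  unfolding holds_def by auto

text \<open>As long as row \<open>p\<close> has a surplus and row \<open>q\<close> a deficit, no
  column scanned so far offers a one to move.\<close>

definition row_inv ::
    "(nat \<Rightarrow> nat) \<Rightarrow> (nat \<Rightarrow> nat) \<Rightarrow> nat \<Rightarrow> nat \<Rightarrow> nat \<Rightarrow> (nat \<Rightarrow> nat \<Rightarrow> nat) \<Rightarrow> bool" where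
  "row_inv \<rho> \<gamma> q p j A \<longleftrightarrow> repair_inv \<rho> \<gamma> q p A \<and>
     (0 < excess \<rho> A p \<longrightarrow> excess \<rho> A q < 0 \<longrightarrow> (\<forall>l<j. A p l \<le> A q l))"

lemma wp_repair_entry:
  assumes A: "holds \<rho> A M" "row_inv \<rho> \<gamma> q p j A" and pq: "p < q" "q < m" "j < n"
    and reg: "M 5 = int q" "M 6 = int p" "M 7 = int j"
    and Q: "\<And>M' A'. holds \<rho> A' M' \<Longrightarrow> row_inv \<rho> \<gamma> q p (Suc j) A' \<Longrightarrow>
      M' 5 = int q \<Longrightarrow> M' 6 = int p \<Longrightarrow> M' 7 = int j \<Longrightarrow> Q M' xs ys"
  shows "wp repair_entry Q M xs ys"
proof -
  let ?ep = "excess \<rho> A p" and ?eq = "excess \<rho> A q"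
  have p: "p < m" using pq by simp
  have rep: "repair_inv \<rho> \<gamma> q p A" using A unfolding row_inv_def by simp
  have le1: "A p j \<le> 1" "A q j \<le> 1"
    using rep p pq unfolding repair_inv_def by blast+
  have mem: "M (adr 7 (pair p j)) = int (A p j)" "M (adr 7 (pair q j)) = int (A q j)"
    "M (adr 6 p) = ?ep" "M (adr 6 q) = ?eq"
    using A p pq unfolding holds_def by auto
  have a7p: "nat (eval (cell 7 (pair_expr (reg 6) (reg 7))) M') = adr 7 (pair p j)"
    and a7q: "nat (eval (cell 7 (pair_expr (reg 5) (reg 7))) M') = adr 7 (pair q j)"
    and a6p: "nat (eval (cell 6 (reg 6)) M') = adr 6 p"
    and a6q: "nat (eval (cell 6 (reg 5)) M') = adr 6 q"
    if "M' 5 = int q" "M' 6 = int p" "M' 7 = int j" for M'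
    by (intro eval_cell eval_pair; use that in simp)+
  note addr = a7p[OF reg] a7q[OF reg] a6p[OF reg] a6q[OF reg]
  have skip: "wp Skip Q M xs ys" if "\<not> (0 < ?ep \<and> ?eq < 0 \<and> 0 < A p j \<and> A q j < 1)"
  proof (rule wp_Skip, rule Q[OF A(1) _ reg])
    show "row_inv \<rho> \<gamma> q p (Suc j) A"
      unfolding row_inv_def
    proof (intro conjI rep impI allI)
      fix l assume "0 < ?ep" "?eq < 0" "l < Suc j"
      then show "A p l \<le> A q l"
        using that A(2) le1 unfolding row_inv_def by (cases "l = j") auto
    qed
  qed
  have move: "wp (Seq (Store (cell 7 (pair_expr (reg 6) (reg 7))) (Const 0))
      (Seq (Store (cell 7 (pair_expr (reg 5) (reg 7))) (Const 1))
        (Seq (Store (cell 6 (reg 6)) (Sub (Reg (cell 6 (reg 6))) (Const 1)))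
          (Seq (Store (cell 6 (reg 5)) (Add (Reg (cell 6 (reg 5))) (Const 1))) Skip)))) Q M xs ys"
    if cond: "0 < ?ep" "?eq < 0" "0 < A p j" "A q j < 1"
  proof -
    have Aj: "A p j = 1" "A q j = 0" using cond le1 by auto
    define A' where "A' = transfer p q j A"
    define M1 where "M1 = M(adr 7 (pair p j) := 0)"
    define M2 where "M2 = M1(adr 7 (pair q j) := 1)"
    define M3 where "M3 = M2(adr 6 p := ?ep - 1)"
    define M4 where "M4 = M3(adr 6 q := ?eq + 1)"
    have ex: "excess \<rho> A' = (excess \<rho> A)(p := ?ep - 1, q := ?eq + 1)"
      unfolding A'_def using pq Aj by (intro excess_transfer) auto
    have reg': "M' 5 = int q" "M' 6 = int p" "M' 7 = int j" if "M' \<in> {M1, M2, M3, M4}" for M'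
      using that reg by (auto simp: M1_def M2_def M3_def M4_def)
    have "holds \<rho> A' M4"
      unfolding holds_def
    proof (intro conjI allI impI)
      show "M4 2 = int m" "M4 3 = int n"
        using A(1) unfolding M4_def M3_def M2_def M1_def holds_def by auto
      show "M4 (adr 7 (pair k l)) = int (A' k l)" if "k < m" "l < n" for k l
        using A(1) that pq unfolding M4_def M3_def M2_def M1_def A'_def transfer_def holds_def by
            auto
      show "M4 (adr 6 k) = excess \<rho> A' k" if "k < m" for k
        using A(1) that pq unfolding ex M4_def M3_def M2_def M1_def holds_def by auto
    qed
    moreover have "row_inv \<rho> \<gamma> q p (Suc j) A'"
      unfolding row_inv_def
    proof (intro conjI impI allI)
      show "repair_inv \<rho> \<gamma> q p A'"
        unfolding A'_def by (rule repair_inv_transfer[OF rep pq Aj cond(1,2)])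
      show "A' p l \<le> A' q l" if "l < Suc j" for l
        using that A(2) cond pq unfolding row_inv_def A'_def transfer_def by (cases "l = j") auto
    qed
    ultimately have Q4: "Q M4 xs ys" by (rule Q) (use reg' in auto)
    have s1: "wp (Store (cell 7 (pair_expr (reg 6) (reg 7))) (Const 0)) Q' M xs ys"
      if "Q' M1 xs ys" for Q'
      using that a7p[OF reg] by (intro wp_Store) (simp_all add: M1_def)
    have s2: "wp (Store (cell 7 (pair_expr (reg 5) (reg 7))) (Const 1)) Q' M1 xs ys"
      if "Q' M2 xs ys" for Q'
      using that a7q[of M1] reg'[of M1] four_le by (intro wp_Store) (simp_all add: M2_def)
    have s3: "wp (Store (cell 6 (reg 6)) (Sub (Reg (cell 6 (reg 6))) (Const 1))) Q' M2 xs ys"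
      if "Q' M3 xs ys" for Q'
    proof (rule wp_Store)
      have a: "nat (eval (cell 6 (reg 6)) M2) = adr 6 p" using a6p[of M2] reg'[of M2] by simp
      have "M2 (adr 6 p) = ?ep" using mem pq unfolding M2_def M1_def by simp
      then have e: "eval (Sub (Reg (cell 6 (reg 6))) (Const 1)) M2 = ?ep - 1"
        by (simp only: eval.simps a)
      show "Q' (M2(nat (eval (cell 6 (reg 6)) M2) := eval (Sub (Reg (cell 6 (reg 6))) (Const 1))
          M2)) xs ys"
        unfolding a e using that unfolding M3_def .
      \<comment> \<open>Decrementing a positive excess does not increase its absolute value, so the
        old bound persists; incrementing a negative one below is alike.\<close>
      assume "bounded_by w M2 xs"
      then have "\<bar>?ep\<bar> \<le> 2 ^ w" using \<open>M2 (adr 6 p) = ?ep\<close> unfolding bounded_by_def by metis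
      then show "\<bar>eval (Sub (Reg (cell 6 (reg 6))) (Const 1)) M2\<bar> \<le> 2 ^ w"
        unfolding e using cond by linarith
    qed
    have s4: "wp (Store (cell 6 (reg 5)) (Add (Reg (cell 6 (reg 5))) (Const 1))) Q' M3 xs ys"
      if "Q' M4 xs ys" for Q'
    proof (rule wp_Store)
      have a: "nat (eval (cell 6 (reg 5)) M3) = adr 6 q" using a6q[of M3] reg'[of M3] by simp
      have "M3 (adr 6 q) = ?eq" using mem pq unfolding M3_def M2_def M1_def by simp
      then have e: "eval (Add (Reg (cell 6 (reg 5))) (Const 1)) M3 = ?eq + 1"
        by (simp only: eval.simps a)
      show "Q' (M3(nat (eval (cell 6 (reg 5)) M3) := eval (Add (Reg (cell 6 (reg 5))) (Const 1))
          M3)) xs ys"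
        unfolding a e using that unfolding M4_def .
      assume "bounded_by w M3 xs"
      then have "\<bar>?eq\<bar> \<le> 2 ^ w" using \<open>M3 (adr 6 q) = ?eq\<close> unfolding bounded_by_def by metis
      then show "\<bar>eval (Add (Reg (cell 6 (reg 5))) (Const 1)) M3\<bar> \<le> 2 ^ w"
        unfolding e using cond by linarith
    qed
    show ?thesis
      by (rule wp_Seq, rule s1, rule wp_Seq, rule s2, rule wp_Seq, rule s3, rule wp_Seq, rule s4,
          rule wp_Skip, rule Q4)
  qed
  have test: "eval (Reg (cell 6 (reg 6))) M = ?ep"
    "eval (Sub (Const 0) (Reg (cell 6 (reg 5)))) M = - ?eq"
    "eval (Reg (cell 7 (pair_expr (reg 6) (reg 7)))) M = int (A p j)"
    "eval (Sub (Const 1) (Reg (cell 7 (pair_expr (reg 5) (reg 7))))) M = 1 - int (A q j)"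
    by (simp_all only: eval.simps addr mem)
  show ?thesis
    unfolding repair_entry_def seqs_simps
    by (intro wp_Cond; unfold test) (rule move skip; linarith)+
qed

lemma wp_repair:
  assumes \<rho>: "\<And>k l. k \<le> l \<Longrightarrow> l < m \<Longrightarrow> \<rho> l \<le> \<rho> k"
    and A: "holds \<rho> A M" "repair_inv \<rho> \<gamma> 0 0 A"
    and Q: "\<And>M' A'. holds \<rho> A' M' \<Longrightarrow> repair_inv \<rho> \<gamma> m 0 A' \<Longrightarrow> Q M' xs ys"
  shows "wp repair Q M xs ys"
  unfolding repair_def
proof (rule wp_For[where K = m and J = "\<lambda>q M' xs' ys'. (\<exists>A. holds \<rho> A M' \<and> repair_inv \<rho> \<gamma> q 0 A) \<and>
    xs' = xs \<and> ys' = ys"], goal_cases)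
  case 1
  then show ?case using A by blast
next
  case (2 q M1 xs1 ys1)
  then show ?case by (auto simp: holds_def)
next
  case (3 q M1 xs1 ys1 x)
  then show ?case by simp
next
  case (4 q M1 xs1 ys1)
  note q = this
  show ?case
  proof (rule wp_For[where K = q and J = "\<lambda>p M' xs' ys'. (\<exists>A. holds \<rho> A M' \<and> repair_inv \<rho> \<gamma> q p A) \<and>
      M' 5 = int q \<and> xs' = xs \<and> ys' = ys"], goal_cases)
    case 1
    then show ?case using q by simp
  next
    case (2 p M2 xs2 ys2)
    then show ?case by simp
  next
    case (3 p M2 xs2 ys2 x)
    then show ?case by simp
  next
    case (4 p M2 xs2 ys2)
    note p = this
    show ?case
    proof (rule wp_For[where K = n and J = "\<lambda>j M' xs' ys'. (\<exists>A. holds \<rho> A M' \<and>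
        row_inv \<rho> \<gamma> q p j A) \<and>
        M' 5 = int q \<and> M' 6 = int p \<and> xs' = xs \<and> ys' = ys"], goal_cases)
      case 1
      then show ?case using p by (auto simp: row_inv_def)
    next
      case (2 j M3 xs3 ys3)
      then show ?case by (auto simp: holds_def)
    next
      case (3 j M3 xs3 ys3 x)
      then show ?case by simp
    next
      case (4 j M3 xs3 ys3)
      then obtain A where "holds \<rho> A M3" "row_inv \<rho> \<gamma> q p j A" by blast
      then show ?case
        by (rule wp_repair_entry) (use 4 p q in auto)
    next
      case (5 M3 xs3 ys3)
      then obtain A where "holds \<rho> A M3" "row_inv \<rho> \<gamma> q p n A" by blast
      moreover from this have "repair_inv \<rho> \<gamma> q (Suc p) A"
        using p q \<rho>[of p q] unfolding row_inv_def by (intro repair_inv_next_row) auto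
      ultimately show ?case using 5 by blast
    next
      case 6
      then show ?case using mn_le by simp
    qed
  next
    case (5 M2 xs2 ys2)
    then show ?case using q repair_inv_next by blast
  next
    case 6
    then show ?case using q mn_le by simp
  qed
next
  case (5 M1 xs1 ys1)
  then show ?case using Q by blast
next
  case 6
  then show ?case using mn_le by simp
qed

section \<open>Output and correctness of the whole program\<close>

lemma wp_write_output:
  assumes A: "holds \<rho> A M" and Q: "\<And>M'. Q M' xs (encode_mat (mat m n (\<lambda>(i, j). A i j)))"
  shows "wp write_output Q M xs []"
  unfolding write_output_def
proof (rule wp_For[where K = m and J = "\<lambda>i M' xs' ys'. holds \<rho> A M' \<and> xs' = xs \<and>
    ys' = concat (map (\<lambda>i. map (\<lambda>j. int (A i j)) [0..<n]) [0..<i])"], goal_cases)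
  case 1
  then show ?case using A by simp
next
  case (2 i M1 xs1 ys1)
  then show ?case by (simp add: holds_def)
next
  case (3 i M1 xs1 ys1 x)
  then show ?case by simp
next
  case (4 i M1 xs1 ys1)
  note i = this
  show ?case
  proof (rule wp_For[where K = n and J = "\<lambda>j M' xs' ys'. holds \<rho> A M' \<and> M' 5 = int i \<and> xs' = xs \<and>
      ys' = concat (map (\<lambda>i. map (\<lambda>j. int (A i j)) [0..<n]) [0..<i]) @
        map (\<lambda>j. int (A i j)) [0..<j]"], goal_cases)
    case 1
    then show ?case using i by simp
  next
    case (2 j M2 xs2 ys2)
    then show ?case by (simp add: holds_def)
  next
    case (3 j M2 xs2 ys2 x)
    then show ?case by simp
  next
    case (4 j M2 xs2 ys2)
    have a: "nat (eval (cell 7 (pair_expr (reg 5) (reg 6))) M2) = adr 7 (pair i j)"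
      by (intro eval_cell eval_pair) (use 4 in simp_all)
    have e: "eval (Reg (cell 7 (pair_expr (reg 5) (reg 6)))) M2 = int (A i j)"
      using 4 i unfolding eval.simps a holds_def by blast
    show ?case
      by (rule wp_Write, unfold e) (use 4 in simp)
  next
    case (5 M2 xs2 ys2)
    then show ?case by simp
  next
    case 6
    then show ?case using mn_le by simp
  qed
next
  case (5 M1 xs1 ys1)
  moreover have "encode_mat (mat m n (\<lambda>(i, j). A i j)) =
      concat (map (\<lambda>i. map (\<lambda>j. int (A i j)) [0..<n]) [0..<m])"
    unfolding encode_mat_def by (intro arg_cong[of _ _ concat] map_cong) auto
  ultimately show ?case using Q by simp
next
  case 6
  then show ?case using mn_le by simp
qed

lemma wp_program:
  assumes "m > 0" "n > 0"
  shows "wp program (\<lambda>_ _ ys. \<exists>A. is_arg_min (degree_cost f g) (\<lambda>B. B \<in> monotone_01_mats m n) A \<and>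
    ys = encode_mat A) (\<lambda>_. 0) (encode_instance m n f g) []" (is "wp _ ?Q _ _ _")
  unfolding program_def seqs_simps
proof (rule wp_Seq, rule wp_read_input, simp, rule wp_Seq, rule wp_fill_tables, assumption,
    rule wp_Seq, rule wp_follow_moves[OF assms], assumption, assumption)
  fix M \<rho> \<kappa>
  assume tr: "trace_inv 0 0 0 0 \<rho> \<kappa>" and opt: "fst (opt 0 0 0 0) = 0"
    and fer: "ferrers m \<rho> \<kappa> M" and M: "M 2 = int m" "M 3 = int n"
  let ?A = "\<lambda>k j. of_bool (j < \<kappa> k)"
  have "(\<Sum>j<n. ?A k j) = \<kappa> k" if "k < m" for k
  proof -
    have "{j. j < n \<and> j < \<kappa> k} = {..<\<kappa> k}"
      using tr that unfolding trace_inv_def by fastforce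
    then show ?thesis by (simp add: Collect_conj_eq[symmetric] lessThan_def)
  qed
  then have A: "holds \<rho> ?A M"
    using fer M unfolding holds_def ferrers_def excess_def by simp
  show "wp (Seq repair (Seq write_output Skip)) ?Q M [] []"
  proof (rule wp_Seq, rule wp_repair[OF _ A repair_inv_init[OF tr]])
    show "\<rho> l \<le> \<rho> k" if "k \<le> l" "l < m" for k l
      using tr that unfolding trace_inv_def by simp
    fix M' A'
    assume A': "holds \<rho> A' M'" "repair_inv \<rho> (col_count m \<kappa>) m 0 A'"
    then show "wp (Seq write_output Skip) ?Q M' [] []"
      using final_mat[OF tr opt A'(2)]
      by (intro wp_Seq wp_write_output[OF A'(1)] wp_Skip) blast
  qed
qed

end

section \<open>Sizes in terms of the input length\<close>

lemma length_le_input_length: "length xs \<le> input_length xs"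
  by (induction xs) (auto simp: input_length_def int_length_def)

lemma int_length_le_input_length: "x \<in> set xs \<Longrightarrow> int_length x \<le> input_length xs"
  unfolding input_length_def by (intro member_le_sum_list) auto

text \<open>The left side is at most the product of the factors \<open>1 + x\<^sup>2\<close>, each
  of which is at most \<open>4 ^ int_length x\<close>; the exponents add up to the input
  length.\<close>

lemma sum_squares_le: "1 + (\<Sum>x\<leftarrow>xs. x\<^sup>2) \<le> 4 ^ input_length xs"
proof (induction xs)
  case (Cons x xs)
  have "1 + x\<^sup>2 \<le> (\<bar>x\<bar> + 1)\<^sup>2"
    by (simp add: power2_eq_square algebra_simps flip: abs_mult)
  also have "\<dots> \<le> (2 ^ int_length x)\<^sup>2"
    using abs_less_two_power_int_length[of x] by (intro power_mono) auto
  also have "\<dots> = 2 ^ (2 * int_length x)" by (simp only: power_mult[symmetric] mult.commute)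
  also have "\<dots> = 4 ^ int_length x" by (simp add: power_mult)
  finally have x: "1 + x\<^sup>2 \<le> 4 ^ int_length x" .
  have nonneg: "0 \<le> (\<Sum>x\<leftarrow>xs. x\<^sup>2)" by (intro sum_list_nonneg) auto
  have "1 + (\<Sum>x\<leftarrow>x # xs. x\<^sup>2) \<le> (1 + x\<^sup>2) * (1 + (\<Sum>x\<leftarrow>xs. x\<^sup>2))"
    using nonneg by (simp add: algebra_simps)
  also have "\<dots> \<le> 4 ^ int_length x * 4 ^ input_length xs"
    using x Cons nonneg by (intro mult_mono) auto
  also have "\<dots> = 4 ^ input_length (x # xs)"
    by (simp add: input_length_def power_add)
  finally show ?case .
qed (simp add: input_length_def)

lemma (in degree_problem) total_le: "1 + total \<le> 4 ^ input_length (encode_instance m n f g)"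
proof -
  have "(\<Sum>x\<leftarrow>concat (map (\<lambda>i. map (h i) [0..<C]) [0..<R]). x\<^sup>2) = (\<Sum>i<R. \<Sum>j<C. (h i j)\<^sup>2)"
    for h :: "nat \<Rightarrow> nat \<Rightarrow> int" and R C
    by (induction R) (simp_all add: interv_sum_list_conv_sum_set_nat atLeast0LessThan o_def)
  note tab = this[of f "n + 1" m] this[of g "m + 1" n]
  have "total \<le> (\<Sum>x\<leftarrow>encode_instance m n f g. x\<^sup>2)"
    unfolding encode_instance_def total_def fsq_def gsq_def map_append sum_list_append tab by simp
  then show ?thesis using sum_squares_le[of "encode_instance m n f g"] by linarith
qed

lemma length_encode_instance: "length (encode_instance m n f g) = 2 * m * n + m + n + 2"
  by (simp add: encode_instance_def length_concat o_def sum_list_triv algebra_simps)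

theorem theorem1p2:
  shows "\<exists>(P :: com) (p :: nat poly). \<forall>(m :: nat) (n :: nat)
      (f :: nat \<Rightarrow> nat \<Rightarrow> int) (g :: nat \<Rightarrow> nat \<Rightarrow> int).
    m > 0 \<longrightarrow> n > 0 \<longrightarrow>
    (\<exists>(A :: nat mat) (t :: nat).
      computes_in_time P (encode_instance m n f g) (encode_mat A) t \<and>
      t \<le> poly p (input_length (encode_instance m n f g)) \<and>
      is_arg_min (degree_cost f g) (\<lambda>B. B \<in> monotone_01_mats m n) A)"
proof -
  \<comment> \<open>The two polynomials are the choices \<open>w = 2 + 2 * L\<close> and
    \<open>N = L\<close> as functions of the input length \<open>L\<close>.\<close>
  obtain p :: "nat poly" where p: "\<And>x. time_bound (poly [:2, 2:] x) (poly [:0, 1:] x) program = poly p x"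
    using time_bound_poly by metis
  show ?thesis
  proof (intro exI[of _ program] exI[of _ p] allI impI)
    fix m n :: nat and f g :: "nat \<Rightarrow> nat \<Rightarrow> int"
    assume mn: "m > 0" "n > 0"
    define xs where "xs = encode_instance m n f g"
    define L where "L = input_length xs"
    interpret degree_machine m n f g "2 + 2 * L" L
    proof
      show "0 < 2 + 2 * L" "2 \<le> 2 + 2 * L" by simp_all
      have "L < 2 ^ L" by (rule less_exp)
      also have "\<dots> \<le> 2 ^ (2 + 2 * L)" by (rule power_increasing) auto
      finally have "int L < int (2 ^ (2 + 2 * L))" unfolding of_nat_less_iff .
      then show "int L \<le> 2 ^ (2 + 2 * L)" by simp
      show "2 * m * n + m + n + 2 \<le> L"
        using length_le_input_length[of xs] unfolding L_def xs_def length_encode_instance .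
      \<comment> \<open>This determines the width: \<open>2 * 4 ^ L\<close> is
        \<open>2 ^ (1 + 2 * L)\<close>, and one more unit ensures \<open>w\<close> is at least 2 for
        every \<open>L\<close>.\<close>
      have "degree_problem.big m n f g \<le> 2 * 4 ^ L"
        unfolding degree_problem.big_def
        using degree_problem.total_le[of m n f g] by (simp add: L_def xs_def)
      also have "\<dots> \<le> 2 ^ (2 + 2 * L)"
        by (simp add: power_add power_mult)
      finally show "degree_problem.big m n f g \<le> 2 ^ (2 + 2 * L)" .
    qed
    have "\<bar>x\<bar> \<le> 2 ^ (2 + 2 * L)" if "x \<in> set xs" for x
    proof -
      have "\<bar>x\<bar> < 2 ^ int_length x" by (rule abs_less_two_power_int_length)
      also have "(2 :: int) ^ int_length x \<le> 2 ^ (2 + 2 * L)"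
        using int_length_le_input_length[OF that] unfolding L_def by (intro power_increasing) auto
      finally show ?thesis by simp
    qed
    then have "bounded_by (2 + 2 * L) (\<lambda>_. 0) xs" by (simp add: bounded_by_def)
    then obtain t M' xs' A where "exec program (\<lambda>_. 0, xs, []) t (M', xs', encode_mat A)"
      "t \<le> time_bound (2 + 2 * L) L program"
      "is_arg_min (degree_cost f g) (\<lambda>B. B \<in> monotone_01_mats m n) A"
      using wp_program[OF mn] unfolding wp_def xs_def by blast
    then show "\<exists>A t. computes_in_time program (encode_instance m n f g) (encode_mat A) t \<and>
        t \<le> poly p (input_length (encode_instance m n f g)) \<and>
        is_arg_min (degree_cost f g) (\<lambda>B. B \<in> monotone_01_mats m n) A"
      using p[of L] unfolding computes_in_time_def L_def xs_def by (auto simp: mult.commute)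
  qed
qed

end
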